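(* Let $N\ge1$, $m,m_1,\dots,m_N\ge1$ be integers, $D^{(t)}\in\mathbb{R}^{m\times m_t}$ given matrices, and $\bm{a}^{(t)}\in\mathbb{R}^{m_t}$ with $\bm{a}^{(t)}\ge0$, $\bm{e}_{m_t}^\top\bm{a}^{(t)}=1$ ($t=1,\dots,N$). Consider the primal problem $$(\mathrm{P})\quad \min_{\bm{w},\{\Pi^{(t)}\}}\ \delta_{\Delta_m}(\bm{w})+\sum_{t}\delta^t_+(\Pi^{(t)})+\sum_t\langle D^{(t)},\Pi^{(t)}\rangle\ \ \text{s.t.}\ \ \Pi^{(t)}\bm{e}_{m_t}=\bm{w},\ (\Pi^{(t)})^\top\bm{e}_m=\bm{a}^{(t)},\ t=1,\dots,N,$$ and the problem $$(\mathrm{D})\quad \min_{\bm{u},\{V^{(t)}\},\{\bm{y}^{(t)}\},\{\bm{z}^{(t)}\}}\ \delta^*_{\Delta_m}(\bm{u})+\sum_t\delta^t_+(V^{(t)})+\sum_t\langle\bm{z}^{(t)},\bm{a}^{(t)}\rangle\ \ \text{s.t.}\ \ \sum_t\bm{y}^{(t)}-\bm{u}=0,\ \ V^{(t)}-D^{(t)}-\bm{y}^{(t)}\bm{e}_{m_t}^\top-\bm{e}_m(\bm{z}^{(t)})^\top=0\ \ \forall t,$$ with $\bm{u},\bm{y}^{(t)}\in\mathbb{R}^m$, $V^{(t)}\in\mathbb{R}^{m\times m_t}$, $\bm{z}^{(t)}\in\mathbb{R}^{m_t}$. For $\beta>0$ define the augmented Lagrangian $$\mathcal{L}_\beta(\bm{u},\{V^{(t)}\},\{\bm{y}^{(t)}\},\{\bm{z}^{(t)}\};\bm{\lambda},\{\Lambda^{(t)}\})=\delta^*_{\Delta_m}(\bm{u})+\sum_t\delta^t_+(V^{(t)})+\sum_t\langle\bm{z}^{(t)},\bm{a}^{(t)}\rangle+\langle\bm{\lambda},\textstyle\sum_t\bm{y}^{(t)}-\bm{u}\rangle$$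 $$+\sum_t\langle\Lambda^{(t)},R^{(t)}\rangle+\tfrac{\beta}{2}\|\textstyle\sum_t\bm{y}^{(t)}-\bm{u}\|^2+\tfrac{\beta}{2}\sum_t\|R^{(t)}\|_F^2,\qquad R^{(t)}:=V^{(t)}-D^{(t)}-\bm{y}^{(t)}\bm{e}_{m_t}^\top-\bm{e}_m(\bm{z}^{(t)})^\top.$$ Let $\beta>0$, $\tau\in(0,\frac{1+\sqrt5}{2})$, and starting from arbitrary $\bm{u}^0,\bm{\lambda}^0,\bm{y}^{(t),0}\in\mathbb{R}^m$, $\bm{z}^{(t),0}\in\mathbb{R}^{m_t}$, $V^{(t),0}\in\mathbb{R}^{m\times m_t}_+$, $\Lambda^{(t),0}\in\mathbb{R}^{m\times m_t}$, generate for $k=0,1,2,\dots$: (1) $(\bm{u}^{k+1},\{V^{(t),k+1}\})=\arg\min_{\bm{u},\{V^{(t)}\}}\mathcal{L}_\beta(\bm{u},\{V^{(t)}\},\{\bm{y}^{(t),k}\},\{\bm{z}^{(t),k}\};\bm{\lambda}^k,\{\Lambda^{(t),k}\})$; (2a) $\{\tilde{\bm{z}}^{(t),k+1}\}=\arg\min_{\{\bm{z}^{(t)}\}}\mathcal{L}_\beta(\bm{u}^{k+1},\{V^{(t),k+1}\},\{\bm{y}^{(t),k}\},\{\bm{z}^{(t)}\};\bm{\lambda}^k,\{\Lambda^{(t),k}\})$; (2b) $\{\bm{y}^{(t),k+1}\}=\arg\min_{\{\bm{y}^{(t)}\}}\mathcal{L}_\beta(\bm{u}^{k+1},\{V^{(t),k+1}\},\{\bm{y}^{(t)}\},\{\tilde{\bm{z}}^{(t),k+1}\};\bm{\lambda}^k,\{\Lambda^{(t),k}\})$;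 (2c) $\{\bm{z}^{(t),k+1}\}=\arg\min_{\{\bm{z}^{(t)}\}}\mathcal{L}_\beta(\bm{u}^{k+1},\{V^{(t),k+1}\},\{\bm{y}^{(t),k+1}\},\{\bm{z}^{(t)}\};\bm{\lambda}^k,\{\Lambda^{(t),k}\})$; (3) $\bm{\lambda}^{k+1}=\bm{\lambda}^k+\tau\beta(\sum_t\bm{y}^{(t),k+1}-\bm{u}^{k+1})$ and $\Lambda^{(t),k+1}=\Lambda^{(t),k}+\tau\beta(V^{(t),k+1}-D^{(t)}-\bm{y}^{(t),k+1}\bm{e}_{m_t}^\top-\bm{e}_m(\bm{z}^{(t),k+1})^\top)$, $t=1,\dots,N$. Then the sequence $\{(\bm{u}^k,\{V^{(t),k}\},\{\bm{y}^{(t),k}\},\{\bm{z}^{(t),k}\})\}$ converges to an optimal solution of (D), and the sequence $\{(\bm{\lambda}^k,\{\Lambda^{(t),k}\})\}$ converges to an optimal solution of (P) (with $\bm{\lambda}$ playing the role of $\bm{w}$ and $\Lambda^{(t)}$ that of $\Pi^{(t)}$).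
   Context: $\bm{e}_k$ is the all-ones vector in $\mathbb{R}^k$; $\Delta_m=\{\bm{w}\in\mathbb{R}^m:\bm{e}_m^\top\bm{w}=1,\bm{w}\ge0\}$; $\delta_{\Delta_m}$ is its indicator function and $\delta^*_{\Delta_m}(\bm{u})=\max_i u_i$ its convex conjugate; $\delta^t_+$ is the indicator function of the entrywise nonnegative matrices in $\mathbb{R}^{m\times m_t}$. $\langle X,Y\rangle=\sum_{ij}x_{ij}y_{ij}$, $\|\cdot\|_F$ the Frobenius norm. All minimizers in steps (1)–(2c) exist and are unique. *)

theory Defs
  imports "HOL-Analysis.Analysis"
begin

text \<open>Conventions: indices are 0-based natural numbers. A vector in R^m is a function
  nat => real vanishing outside {..<m}; the t-th block (t < N) of a family of vectors/matrices
  is obtained by applying the family to t; everything vanishes outside its index range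
  (so minimizers over these carriers are genuinely unique).\<close>

definition vecs :: "nat \<Rightarrow> (nat \<Rightarrow> real) set" where
  "vecs m = {x. \<forall>i. m \<le> i \<longrightarrow> x i = 0}"

definition famVec :: "nat \<Rightarrow> nat \<Rightarrow> (nat \<Rightarrow> nat \<Rightarrow> real) set" where
  "famVec N m = {y. \<forall>t i. (N \<le> t \<or> m \<le> i) \<longrightarrow> y t i = 0}"

definition famVecT :: "nat \<Rightarrow> (nat \<Rightarrow> nat) \<Rightarrow> (nat \<Rightarrow> nat \<Rightarrow> real) set" where
  "famVecT N mt = {z. \<forall>t j. (N \<le> t \<or> mt t \<le> j) \<longrightarrow> z t j = 0}"

definition famMat :: "nat \<Rightarrow> nat \<Rightarrow> (nat \<Rightarrow> nat) \<Rightarrow> (nat \<Rightarrow> nat \<Rightarrow> nat \<Rightarrow> real) set" where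
  "famMat N m mt = {V. \<forall>t i j. (N \<le> t \<or> m \<le> i \<or> mt t \<le> j) \<longrightarrow> V t i j = 0}"

definition prob_simplex :: "nat \<Rightarrow> (nat \<Rightarrow> real) set" where
  "prob_simplex m = {w \<in> vecs m. (\<Sum>i<m. w i) = 1 \<and> (\<forall>i<m. 0 \<le> w i)}"

definition ind_simplex :: "nat \<Rightarrow> (nat \<Rightarrow> real) \<Rightarrow> ereal" where
  "ind_simplex m w = (if w \<in> prob_simplex m then 0 else \<infinity>)"

definition conj_simplex :: "nat \<Rightarrow> (nat \<Rightarrow> real) \<Rightarrow> ereal" where
  "conj_simplex m u = (SUP w\<in>prob_simplex m. ereal (\<Sum>i<m. u i * w i) - ind_simplex m w)"

definition ind_nonneg :: "nat \<Rightarrow> nat \<Rightarrow> (nat \<Rightarrow> nat) \<Rightarrow> (nat \<Rightarrow> nat \<Rightarrow> nat \<Rightarrow> real) \<Rightarrow> ereal" where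
  "ind_nonneg N m mt V =
     (\<Sum>t<N. if (\<forall>i<m. \<forall>j<mt t. 0 \<le> V t i j) then 0 else \<infinity>)"

text \<open>R^(t) = V^(t) - D^(t) - y^(t) e^T - e (z^(t))^T, entry (i,j)\<close>
definition resid :: "(nat \<Rightarrow> nat \<Rightarrow> nat \<Rightarrow> real) \<Rightarrow> (nat \<Rightarrow> nat \<Rightarrow> nat \<Rightarrow> real)
    \<Rightarrow> (nat \<Rightarrow> nat \<Rightarrow> real) \<Rightarrow> (nat \<Rightarrow> nat \<Rightarrow> real) \<Rightarrow> nat \<Rightarrow> nat \<Rightarrow> nat \<Rightarrow> real" where
  "resid D V y z t i j = V t i j - D t i j - y t i - z t j"

definition P_obj :: "nat \<Rightarrow> nat \<Rightarrow> (nat \<Rightarrow> nat) \<Rightarrow> (nat \<Rightarrow> nat \<Rightarrow> nat \<Rightarrow> real)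
    \<Rightarrow> (nat \<Rightarrow> real) \<Rightarrow> (nat \<Rightarrow> nat \<Rightarrow> nat \<Rightarrow> real) \<Rightarrow> ereal" where
  "P_obj N m mt D w PP = ind_simplex m w + ind_nonneg N m mt PP
     + ereal (\<Sum>t<N. \<Sum>i<m. \<Sum>j<mt t. D t i j * PP t i j)"

definition P_feas :: "nat \<Rightarrow> nat \<Rightarrow> (nat \<Rightarrow> nat) \<Rightarrow> (nat \<Rightarrow> nat \<Rightarrow> real)
    \<Rightarrow> (nat \<Rightarrow> real) \<Rightarrow> (nat \<Rightarrow> nat \<Rightarrow> nat \<Rightarrow> real) \<Rightarrow> bool" where
  "P_feas N m mt a w PP \<longleftrightarrow> w \<in> vecs m \<and> PP \<in> famMat N m mt \<and>
     (\<forall>t<N. \<forall>i<m. (\<Sum>j<mt t. PP t i j) = w i) \<and>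
     (\<forall>t<N. \<forall>j<mt t. (\<Sum>i<m. PP t i j) = a t j)"

definition P_optimal where
  "P_optimal N m mt a D w PP \<longleftrightarrow> P_feas N m mt a w PP \<and>
     (\<forall>w' PP'. P_feas N m mt a w' PP' \<longrightarrow> P_obj N m mt D w PP \<le> P_obj N m mt D w' PP')"

definition D_obj :: "nat \<Rightarrow> nat \<Rightarrow> (nat \<Rightarrow> nat) \<Rightarrow> (nat \<Rightarrow> nat \<Rightarrow> real)
    \<Rightarrow> (nat \<Rightarrow> real) \<Rightarrow> (nat \<Rightarrow> nat \<Rightarrow> nat \<Rightarrow> real) \<Rightarrow> (nat \<Rightarrow> nat \<Rightarrow> real) \<Rightarrow> ereal" where
  "D_obj N m mt a u V z = conj_simplex m u + ind_nonneg N m mt V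
     + ereal (\<Sum>t<N. \<Sum>j<mt t. z t j * a t j)"

definition D_feas where
  "D_feas N m mt D u V y z \<longleftrightarrow> u \<in> vecs m \<and> V \<in> famMat N m mt \<and> y \<in> famVec N m \<and>
     z \<in> famVecT N mt \<and>
     (\<forall>i<m. (\<Sum>t<N. y t i) - u i = 0) \<and>
     (\<forall>t<N. \<forall>i<m. \<forall>j<mt t. resid D V y z t i j = 0)"

definition D_optimal where
  "D_optimal N m mt a D u V y z \<longleftrightarrow> D_feas N m mt D u V y z \<and>
     (\<forall>u' V' y' z'. D_feas N m mt D u' V' y' z' \<longrightarrow>
        D_obj N m mt a u V z \<le> D_obj N m mt a u' V' z')"

definition AL :: "nat \<Rightarrow> nat \<Rightarrow> (nat \<Rightarrow> nat) \<Rightarrow> (nat \<Rightarrow> nat \<Rightarrow> real) \<Rightarrow> (nat \<Rightarrow> nat \<Rightarrow> nat \<Rightarrow> real)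
   \<Rightarrow> real \<Rightarrow> (nat \<Rightarrow> real) \<Rightarrow> (nat \<Rightarrow> nat \<Rightarrow> nat \<Rightarrow> real) \<Rightarrow> (nat \<Rightarrow> nat \<Rightarrow> real)
   \<Rightarrow> (nat \<Rightarrow> nat \<Rightarrow> real) \<Rightarrow> (nat \<Rightarrow> real) \<Rightarrow> (nat \<Rightarrow> nat \<Rightarrow> nat \<Rightarrow> real) \<Rightarrow> ereal" where
  "AL N m mt a D \<beta> u V y z lam Lam =
     conj_simplex m u + ind_nonneg N m mt V +
     ereal ((\<Sum>t<N. \<Sum>j<mt t. z t j * a t j)
       + (\<Sum>i<m. lam i * ((\<Sum>t<N. y t i) - u i))
       + (\<Sum>t<N. \<Sum>i<m. \<Sum>j<mt t. Lam t i j * resid D V y z t i j)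
       + \<beta> / 2 * (\<Sum>i<m. ((\<Sum>t<N. y t i) - u i)^2)
       + \<beta> / 2 * (\<Sum>t<N. \<Sum>i<m. \<Sum>j<mt t. (resid D V y z t i j)^2))"

end

theory Submission
  imports Defs
begin

text \<open>Each \<open>z\<close>-subproblem is solved exactly, so \<open>zt (Suc k)\<close> and \<open>z (Suc k)\<close> differ by the mean over \<open>i\<close>
  of \<open>y (Suc k) - y k\<close>. Eliminating \<open>zt\<close> shows that steps (2a)--(2c) perform one exact minimization
  in \<open>(y, z)\<close> with the additional proximal seminorm whose square is the sum over \<open>t\<close> of
  \<open>(\<beta> * mt t / m) * (S t)\<^sup>2\<close>, \<open>S t\<close> being the sum of the entries of \<open>y t\<close>. The scheme is therefore a
  two-block semi-proximal ADMM. For every KKT point, the weighted squared distance of the multipliers,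
  of the image of \<open>(y, z)\<close> under the constraint map and of \<open>S\<close>, plus a multiple of the last residual
  and of the last increment of \<open>S\<close>, decreases; the bound on \<open>\<tau>\<close> makes the decrease control the
  residuals. Cluster points are KKT points, and Fejer monotonicity upgrades this to convergence.
  The image under the constraint map together with \<open>S\<close> determines \<open>(y, z)\<close>. A KKT point exists by
  linear programming duality, which is derived from Farkas' lemma.\<close>

text \<open>The constraint map on \<open>(y, z)\<close> is not injective once \<open>N\<close>
  exceeds 1: adding a constant c t to \<open>y t\<close> and subtracting it from \<open>z t\<close>
  is invisible to it when the c t sum to zero. The usual ADMM energy therefore cannot bound
  \<open>y\<close> and \<open>z\<close> separately. Such a shift changes \<open>S t\<close> by m * c
  t, so the proximal term closes exactly this gap. Its weight is the symmetric Gauss-Seidel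
  correction: the Hessian block of \<open>z\<close> is \<beta> * m times the identity, each of the
  \<open>mt t\<close> entries of \<open>z t\<close> couples to \<open>y\<close> through \<beta> * S
  t, and eliminating \<open>z\<close> gives (\<beta> * S t)^2 * mt t / (\<beta> * m). The energy
  omits the first block because vanishing residuals recover \<open>u\<close> and \<open>V\<close>
  from \<open>y\<close> and \<open>z\<close>. For \<tau> other than 1, subtracting consecutive
  optimality conditions leaves a mixed term with factor 1 - \<tau> between the previous residual and
  the increment of the image. The decrease, proportional to 2 - \<tau>, has to absorb it; for \<tau>
  > 1 something is left precisely because \<tau>^2 < 1 + \<tau>.\<close>

section \<open>Linear programming duality\<close>

text \<open>A pair \<open>(f, b)\<close> encodes the inequality with coefficients \<open>f\<close>
  and right-hand side \<open>b\<close>; the rules generate the consequences obtained by nonnegative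
  combination. A member with \<open>f\<close> zero on the index set and \<open>b\<close> negative is
  a proof of infeasibility.\<close>

inductive_set ineq_cone :: "(('j \<Rightarrow> real) \<times> real) set \<Rightarrow> (('j \<Rightarrow> real) \<times> real) set"
  for S where
  zero: "((\<lambda>_. 0), 0) \<in> ineq_cone S"
| gen: "p \<in> S \<Longrightarrow> p \<in> ineq_cone S"
| add: "(f, b) \<in> ineq_cone S \<Longrightarrow> (g, c) \<in> ineq_cone S \<Longrightarrow> ((\<lambda>j. f j + g j), b + c) \<in> ineq_cone S"
| scale: "0 \<le> s \<Longrightarrow> (f, b) \<in> ineq_cone S \<Longrightarrow> ((\<lambda>j. s * f j), s * b) \<in> ineq_cone S"

lemma ineq_cone_subset:
  assumes "S' \<subseteq> ineq_cone S"
  shows "ineq_cone S' \<subseteq> ineq_cone S"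
proof
  fix p assume "p \<in> ineq_cone S'"
  then show "p \<in> ineq_cone S"
    by induction (use assms in \<open>auto intro: ineq_cone.intros\<close>)
qed

lemma real_between_finite_sets:
  fixes L U :: "real set"
  assumes "finite L" "finite U" "\<And>l u. l \<in> L \<Longrightarrow> u \<in> U \<Longrightarrow> l \<le> u"
  obtains x where "\<And>l. l \<in> L \<Longrightarrow> l \<le> x" "\<And>u. u \<in> U \<Longrightarrow> x \<le> u"
proof (cases "L = {}")
  case True
  show ?thesis
  proof (cases "U = {}")
    case False
    with True assms show ?thesis by (intro that[of "Min U"]) auto
  qed (use True that in auto)
next
  case False
  with assms show ?thesis by (intro that[of "Max L"]) auto
qed

text \<open>Fourier--Motzkin: the variable \<open>j\<close> is eliminated by combining each inequality in which its
  coefficient is positive with each one in which it is negative.\<close>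

theorem farkas_ineq_cone:
  assumes "finite J" "finite S"
    and "\<And>f b. (f, b) \<in> ineq_cone S \<Longrightarrow> (\<And>j. j \<in> J \<Longrightarrow> f j = 0) \<Longrightarrow> 0 \<le> b"
  shows "\<exists>x. \<forall>(f, b)\<in>S. (\<Sum>j\<in>J. f j * x j) \<le> b"
  using assms
proof (induction J arbitrary: S rule: finite_induct)
  case empty
  then show ?case by (auto intro: ineq_cone.gen)
next
  case (insert j J)
  \<comment> \<open>Both multipliers are positive for \<open>p\<close> in \<open>P\<close> and
    \<open>q\<close> in \<open>Q\<close>, and they cancel the coefficient of
    \<open>j\<close>.\<close>
  define comb where "comb p q = ((\<lambda>i. (- fst q j) * fst p i + fst p j * fst q i),
      (- fst q j) * snd p + fst p j * snd q)" for p q :: "('a \<Rightarrow> real) \<times> real"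
  define P where "P = {p \<in> S. fst p j > 0}"
  define Q where "Q = {p \<in> S. fst p j < 0}"
  define S' where "S' = {p \<in> S. fst p j = 0} \<union> (\<lambda>(p, q). comb p q) ` (P \<times> Q)"
  have fin: "finite P" "finite Q" "finite S'"
    using insert.prems(1) by (auto simp: P_def Q_def S'_def)
  have comb_in: "comb p q \<in> ineq_cone S" if "p \<in> P" "q \<in> Q" for p q
    unfolding comb_def using that
    by (intro ineq_cone.add ineq_cone.scale) (auto simp: P_def Q_def intro: ineq_cone.gen)
  have sub: "ineq_cone S' \<subseteq> ineq_cone S"
    by (rule ineq_cone_subset) (auto simp: S'_def intro: ineq_cone.gen comb_in)
  \<comment> \<open>Every inequality generated from \<open>S'\<close> is free of \<open>j\<close>,
    so vanishing on \<open>J\<close> already means vanishing on \<open>insert j J\<close>, and the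
    hypothesis on \<open>S\<close> transfers.\<close>
  have j0: "fst p j = 0" if "p \<in> ineq_cone S'" for p
    using that by induction (auto simp: S'_def comb_def)
  have "\<exists>x. \<forall>(f, b)\<in>S'. (\<Sum>j\<in>J. f j * x j) \<le> b"
  proof (rule insert.IH[OF fin(3)])
    fix f b assume fb: "(f, b) \<in> ineq_cone S'" and z: "\<And>j. j \<in> J \<Longrightarrow> f j = 0"
    from fb have "(f, b) \<in> ineq_cone S" using sub by blast
    moreover have "f i = 0" if "i \<in> insert j J" for i
      using that z j0[OF fb] by auto
    ultimately show "0 \<le> b" by (rule insert.prems(2))
  qed
  then obtain x where x: "\<And>p. p \<in> S' \<Longrightarrow> (\<Sum>j\<in>J. fst p j * x j) \<le> snd p"
    by fastforce
  \<comment> \<open>The bound that \<open>p\<close> puts on the eliminated variable once the others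
    are fixed at \<open>x\<close>: an upper bound for \<open>P\<close>, a lower bound for
    \<open>Q\<close>.\<close>
  define g where "g p = (snd p - (\<Sum>j\<in>J. fst p j * x j)) / fst p j" for p :: "('a \<Rightarrow> real) \<times> real"
  obtain \<xi> where \<xi>: "\<And>l. l \<in> g ` Q \<Longrightarrow> l \<le> \<xi>" "\<And>u. u \<in> g ` P \<Longrightarrow> \<xi> \<le> u"
  proof (rule real_between_finite_sets[of "g ` Q" "g ` P"])
    fix l u assume "l \<in> g ` Q" "u \<in> g ` P"
    then obtain p q where pq: "p \<in> P" "q \<in> Q" "l = g q" "u = g p" by auto
    have "comb p q \<in> S'" using pq unfolding S'_def by auto
    from x[OF this] have "- fst q j * (\<Sum>j\<in>J. fst p j * x j) + fst p j * (\<Sum>j\<in>J. fst q j * x j)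
        \<le> - fst q j * snd p + fst p j * snd q"
      by (simp add: comb_def sum.distrib sum_subtractf sum_negf sum_distrib_left algebra_simps)
    then have "fst q j * (snd p - (\<Sum>j\<in>J. fst p j * x j)) \<le> fst p j * (snd q - (\<Sum>j\<in>J. fst q j * x j))"
      by (simp add: algebra_simps)
    moreover have "fst p j > 0" "fst q j < 0" using pq by (auto simp: P_def Q_def)
    ultimately show "l \<le> u" unfolding pq g_def by (simp add: divide_simps mult.commute)
  qed (use fin in auto)
  have "(\<Sum>i\<in>insert j J. fst p i * (x(j := \<xi>)) i) \<le> snd p" if "p \<in> S" for p
  proof -
    have "(\<Sum>i\<in>J. fst p i * (x(j := \<xi>)) i) = (\<Sum>i\<in>J. fst p i * x i)"
      using insert.hyps by (intro sum.cong) auto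
    then have e: "(\<Sum>i\<in>insert j J. fst p i * (x(j := \<xi>)) i) = fst p j * \<xi> + (\<Sum>i\<in>J. fst p i * x i)"
      using insert.hyps by simp
    consider "fst p j = 0" | "fst p j > 0" | "fst p j < 0" by linarith
    then show ?thesis
    proof cases
      case 1
      then show ?thesis using x[of p] that e by (auto simp: S'_def)
    next
      case 2
      then have "\<xi> \<le> g p" using that \<xi>(2) by (auto simp: P_def)
      then show ?thesis using 2 e by (simp add: g_def field_simps)
    next
      case 3
      then have "g p \<le> \<xi>" using that \<xi>(1) by (auto simp: Q_def)
      then show ?thesis using 3 e by (simp add: g_def field_simps)
    qed
  qed
  then show ?case by (intro exI[of _ "x(j := \<xi>)"]) auto
qed

text \<open>Farkas' lemma is applied to one joint system in \<open>(x, l)\<close>: primal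
  feasibility, dual feasibility and the reverse of weak duality. Any solution of it is an optimal
  pair.\<close>

theorem lp_strong_duality:
  fixes A :: "'i \<Rightarrow> 'j \<Rightarrow> real"
  assumes fin: "finite I" "finite J"
    and x0: "\<And>i. i \<in> I \<Longrightarrow> b i \<le> (\<Sum>j\<in>J. A i j * x0 j)"
    and l0: "\<And>i. i \<in> I \<Longrightarrow> 0 \<le> l0 i" "\<And>j. j \<in> J \<Longrightarrow> (\<Sum>i\<in>I. l0 i * A i j) = c j"
  obtains x l where "\<And>i. i \<in> I \<Longrightarrow> b i \<le> (\<Sum>j\<in>J. A i j * x j)"
    "\<And>i. i \<in> I \<Longrightarrow> 0 \<le> l i" "\<And>j. j \<in> J \<Longrightarrow> (\<Sum>i\<in>I. l i * A i j) = c j"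
    "(\<Sum>j\<in>J. c j * x j) \<le> (\<Sum>i\<in>I. b i * l i)"
proof -
  \<comment> \<open>\<open>Inl\<close> carries \<open>x\<close> and \<open>Inr\<close> carries
    \<open>l\<close>. \<open>C1\<close> is primal feasibility, \<open>C2\<close> the sign of
    \<open>l\<close>, \<open>C3\<close> and \<open>C4\<close> the two halves of the dual equation,
    \<open>C5\<close> the gap inequality.\<close>
  define C1 where "C1 i = (case_sum (\<lambda>j. - A i j) (\<lambda>_::'i. 0), - b i)" for i
  define C2 where "C2 i = (case_sum (\<lambda>j::'j. 0::real) (\<lambda>i'::'i. if i' = i then - 1 else 0), 0::real)" for i
  define C3 where "C3 j = (case_sum (\<lambda>j::'j. 0::real) (\<lambda>i. A i j), c j)" for j
  define C4 where "C4 j = (case_sum (\<lambda>j::'j. 0::real) (\<lambda>i. - A i j), - c j)" for j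
  define C5 where "C5 = (case_sum c (\<lambda>i. - b i), 0::real)"
  define S where "S = insert C5 (C1 ` I \<union> C2 ` I \<union> C3 ` J \<union> C4 ` J)"
  \<comment> \<open>Here \<open>p\<close> collects the multipliers of \<open>C1\<close>,
    \<open>v\<close> those of \<open>C3\<close> minus those of \<open>C4\<close>, and
    \<open>s\<close> that of \<open>C5\<close>. The multipliers of \<open>C2\<close> survive only as
    slack in the \<open>Inr\<close> inequality.\<close>
  have cert: "\<exists>p v s. (\<forall>i\<in>I. 0 \<le> p i) \<and> 0 \<le> s
      \<and> (\<forall>j\<in>J. fst q (Inl j) = s * c j - (\<Sum>i\<in>I. p i * A i j))
      \<and> (\<forall>i\<in>I. fst q (Inr i) \<le> (\<Sum>j\<in>J. A i j * v j) - s * b i)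
      \<and> snd q = (\<Sum>j\<in>J. c j * v j) - (\<Sum>i\<in>I. b i * p i)" if "q \<in> ineq_cone S" for q
    using that
  proof induction
    case zero
    show ?case by (intro exI[of _ "\<lambda>_. 0"] exI[of _ 0]) auto
  next
    case (gen q)
    then consider "q = C5" | i where "i \<in> I" "q = C1 i" | i where "i \<in> I" "q = C2 i"
      | j where "j \<in> J" "q = C3 j" | j where "j \<in> J" "q = C4 j"
      unfolding S_def by auto
    then show ?case
    proof cases
      case 1
      then show ?thesis
        by (intro exI[of _ "\<lambda>_. 0"] exI[of _ 1]) (auto simp: C5_def)
    next
      case 2
      then show ?thesis
        by (intro exI[of _ "\<lambda>i'. if i' = i then 1 else 0"] exI[of _ "\<lambda>_. 0"] exI[of _ 0])
          (auto simp: C1_def fin if_distrib[of "\<lambda>x. _ * x"] if_distrib[of "\<lambda>x. x * _"] cong: if_cong)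
    next
      case 3
      then show ?thesis
        by (intro exI[of _ "\<lambda>_. 0"] exI[of _ 0]) (auto simp: C2_def)
    next
      case 4
      then show ?thesis
        by (intro exI[of _ "\<lambda>j'. if j' = j then 1 else 0"] exI[of _ "\<lambda>_. 0"] exI[of _ 0])
          (auto simp: C3_def fin if_distrib[of "\<lambda>x. _ * x"] if_distrib[of "\<lambda>x. x * _"] cong: if_cong)
    next
      case 5
      then show ?thesis
        by (intro exI[of _ "\<lambda>j'. if j' = j then - 1 else 0"] exI[of _ "\<lambda>_. 0"] exI[of _ 0])
          (auto simp: C4_def fin if_distrib[of "\<lambda>x. _ * x"] if_distrib[of "\<lambda>x. x * _"] cong: if_cong)
    qed
  next
    case (add f \<beta> g \<gamma>)
    then obtain p v s p' v' s' where
      "\<forall>i\<in>I. 0 \<le> p i" "0 \<le> s" "\<forall>j\<in>J. f (Inl j) = s * c j - (\<Sum>i\<in>I. p i * A i j)"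
      "\<forall>i\<in>I. f (Inr i) \<le> (\<Sum>j\<in>J. A i j * v j) - s * b i"
      "\<beta> = (\<Sum>j\<in>J. c j * v j) - (\<Sum>i\<in>I. b i * p i)"
      "\<forall>i\<in>I. 0 \<le> p' i" "0 \<le> s'" "\<forall>j\<in>J. g (Inl j) = s' * c j - (\<Sum>i\<in>I. p' i * A i j)"
      "\<forall>i\<in>I. g (Inr i) \<le> (\<Sum>j\<in>J. A i j * v' j) - s' * b i"
      "\<gamma> = (\<Sum>j\<in>J. c j * v' j) - (\<Sum>i\<in>I. b i * p' i)"
      by auto
    then show ?case
      by (intro exI[of _ "\<lambda>i. p i + p' i"] exI[of _ "\<lambda>i. v i + v' i"] exI[of _ "s + s'"])
        (fastforce simp: sum.distrib algebra_simps)
  next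
    case (scale r f \<beta>)
    then obtain p v s where *:
      "\<forall>i\<in>I. 0 \<le> p i" "0 \<le> s" "\<forall>j\<in>J. f (Inl j) = s * c j - (\<Sum>i\<in>I. p i * A i j)"
      "\<forall>i\<in>I. f (Inr i) \<le> (\<Sum>j\<in>J. A i j * v j) - s * b i"
      "\<beta> = (\<Sum>j\<in>J. c j * v j) - (\<Sum>i\<in>I. b i * p i)"
      by auto
    have "r * f (Inr i) \<le> (\<Sum>j\<in>J. A i j * (r * v j)) - r * s * b i" if "i \<in> I" for i
    proof -
      have "r * f (Inr i) \<le> r * ((\<Sum>j\<in>J. A i j * v j) - s * b i)"
        using * that scale by (intro mult_left_mono) auto
      then show ?thesis by (simp add: sum_distrib_left right_diff_distrib mult_ac)
    qed
    moreover have "r * f (Inl j) = r * s * c j - (\<Sum>i\<in>I. r * p i * A i j)" if "j \<in> J" for j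
      using * that by (simp add: sum_distrib_left right_diff_distrib mult_ac)
    moreover have "r * \<beta> = (\<Sum>j\<in>J. c j * (r * v j)) - (\<Sum>i\<in>I. b i * (r * p i))"
      unfolding *(5) by (simp add: sum_distrib_left right_diff_distrib mult_ac)
    ultimately show ?case using * scale
      by (intro exI[of _ "\<lambda>i. r * p i"] exI[of _ "\<lambda>i. r * v i"] exI[of _ "r * s"]) simp
  qed
  have "\<exists>x. \<forall>(f, \<beta>)\<in>S. (\<Sum>j\<in>J <+> I. f j * x j) \<le> \<beta>"
  proof (rule farkas_ineq_cone)
    fix f \<beta> assume "(f, \<beta>) \<in> ineq_cone S" and z: "\<And>j. j \<in> J <+> I \<Longrightarrow> f j = 0"
    from cert[OF this(1)] obtain p v s where *: "\<forall>i\<in>I. 0 \<le> p i" and s: "0 \<le> s"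
      and **: "\<forall>j\<in>J. f (Inl j) = s * c j - (\<Sum>i\<in>I. p i * A i j)"
        "\<forall>i\<in>I. f (Inr i) \<le> (\<Sum>j\<in>J. A i j * v j) - s * b i"
      and \<beta>: "\<beta> = (\<Sum>j\<in>J. c j * v j) - (\<Sum>i\<in>I. b i * p i)"
      by auto
    have p: "\<And>i. i \<in> I \<Longrightarrow> 0 \<le> p i" using * by blast
    have pA: "(\<Sum>i\<in>I. p i * A i j) = s * c j" if "j \<in> J" for j
      using ** z[OF InlI[OF that]] that by simp
    have Av: "s * b i \<le> (\<Sum>j\<in>J. A i j * v j)" if "i \<in> I" for i
      using ** z[OF InrI[OF that]] that by fastforce
    have swap: "(\<Sum>j\<in>J. (\<Sum>i\<in>I. l i * A i j) * w j) = (\<Sum>i\<in>I. l i * (\<Sum>j\<in>J. A i j * w j))" for l w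
      unfolding sum_distrib_left sum_distrib_right by (subst sum.swap) (simp add: mult.assoc)
    \<comment> \<open>If \<open>s\<close> is positive, this is weak duality for \<open>v\<close> and
      \<open>p\<close> divided by \<open>s\<close>. If \<open>s\<close> is 0, these are mere
      recession directions, and the feasible points \<open>l0\<close> and \<open>x0\<close> give the
      signs of the two sums separately.\<close>
    show "0 \<le> \<beta>"
    proof (cases "s = 0")
      case True
      have "(\<Sum>j\<in>J. c j * v j) = (\<Sum>i\<in>I. l0 i * (\<Sum>j\<in>J. A i j * v j))"
        using l0(2) by (simp flip: swap)
      also have "\<dots> \<ge> 0" using l0 Av True by (intro sum_nonneg) auto
      finally have "(\<Sum>j\<in>J. c j * v j) \<ge> 0" .
      moreover have "(\<Sum>i\<in>I. b i * p i) \<le> (\<Sum>i\<in>I. p i * (\<Sum>j\<in>J. A i j * x0 j))"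
        unfolding mult.commute[of "b _"] using p x0 by (intro sum_mono mult_left_mono) auto
      moreover have "\<dots> = 0" using pA True by (simp flip: swap)
      ultimately show ?thesis using \<beta> by simp
    next
      case False
      have "s * (\<Sum>i\<in>I. b i * p i) = (\<Sum>i\<in>I. p i * (s * b i))"
        by (simp add: sum_distrib_left mult_ac)
      also have "\<dots> \<le> (\<Sum>i\<in>I. p i * (\<Sum>j\<in>J. A i j * v j))"
        using p Av by (intro sum_mono mult_left_mono) auto
      also have "\<dots> = s * (\<Sum>j\<in>J. c j * v j)"
        unfolding swap[symmetric] using pA by (simp add: sum_distrib_left mult.assoc)
      finally show ?thesis using s False \<beta> by (simp add: mult_le_cancel_left)
    qed
  qed (use fin in \<open>auto simp: S_def\<close>)
  then obtain xl where xl: "\<And>p. p \<in> S \<Longrightarrow> (\<Sum>j\<in>J. fst p (Inl j) * xl (Inl j)) + (\<Sum>i\<in>I. fst p (Inr i) * xl (Inr i)) \<le> snd p"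
    by (fastforce simp: sum.Plus fin)
  show ?thesis
  proof (rule that[of "\<lambda>j. xl (Inl j)" "\<lambda>i. xl (Inr i)"])
    fix i assume i: "i \<in> I"
    then have "C1 i \<in> S" "C2 i \<in> S" by (auto simp: S_def)
    from xl[OF this(1)] show "b i \<le> (\<Sum>j\<in>J. A i j * xl (Inl j))"
      by (simp add: C1_def sum_negf)
    from xl[OF \<open>C2 i \<in> S\<close>] show "0 \<le> xl (Inr i)"
      using i fin by (simp add: C2_def if_distrib[of "\<lambda>x. x * _"] cong: if_cong)
  next
    fix j assume "j \<in> J"
    then have "C3 j \<in> S" "C4 j \<in> S" by (auto simp: S_def)
    from this[THEN xl] show "(\<Sum>i\<in>I. xl (Inr i) * A i j) = c j"
      by (simp add: C3_def C4_def sum_negf mult.commute)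
  next
    have "C5 \<in> S" by (simp add: S_def)
    from xl[OF this] show "(\<Sum>j\<in>J. c j * xl (Inl j)) \<le> (\<Sum>i\<in>I. b i * xl (Inr i))"
      by (simp add: C5_def sum_negf)
  qed
qed

section \<open>Descent and Fejer monotonicity\<close>

text \<open>The weights used in \<open>admm_descent\<close>; the bound on \<open>\<tau>\<close> is exactly what makes \<open>\<epsilon>\<close> positive.\<close>

lemma golden_ratio_weights:
  fixes \<tau> :: real
  assumes "0 < \<tau>" "\<tau> < (1 + sqrt 5) / 2"
  obtains \<kappa> \<epsilon> where "0 \<le> \<kappa>" "0 < \<epsilon>" "\<epsilon> \<le> 1" "\<kappa> + \<epsilon> \<le> 2 - \<tau>" "(1 - \<tau>)\<^sup>2 \<le> \<kappa> * (1 - \<epsilon>)"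
proof (cases "\<tau> \<le> 1")
  case True
  \<comment> \<open>With these values the last inequality is an equality, and \<kappa> + \<epsilon>
    = 1 is at most 2 - \<tau>.\<close>
  then show ?thesis using assms by (intro that[of "1 - \<tau>" \<tau>]) (auto simp: power2_eq_square)
next
  case False
  have "\<tau> * 2 - 1 < sqrt 5" using assms by simp
  then have "(\<tau> * 2 - 1)\<^sup>2 < (sqrt 5)\<^sup>2"
    using False by (intro power_strict_mono) auto
  then have gold: "\<tau> * \<tau> < 1 + \<tau>"
    by (simp add: power2_eq_square algebra_simps)
  show ?thesis
  \<comment> \<open>These weights exhaust the budget, \<kappa> + \<epsilon> = 2 - \<tau>. The
    product condition then reduces to (1 + \<tau>) / \<tau>^2 being at least 1, the same inequality
    as positivity of \<epsilon>.\<close>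
  proof (rule that[of "1 - 1 / \<tau>" "(1 + \<tau> - \<tau> * \<tau>) / \<tau>"])
    show "0 \<le> 1 - 1 / \<tau>" "0 < (1 + \<tau> - \<tau> * \<tau>) / \<tau>"
      "1 - 1 / \<tau> + (1 + \<tau> - \<tau> * \<tau>) / \<tau> \<le> 2 - \<tau>"
      using False gold by (auto simp: field_simps)
    have "1 * 1 \<le> \<tau> * \<tau>" using False by (intro mult_mono) auto
    then show "(1 + \<tau> - \<tau> * \<tau>) / \<tau> \<le> 1" using False by (auto simp: field_simps)
    have "(1 - \<tau>)\<^sup>2 * 1 \<le> (1 - \<tau>)\<^sup>2 * ((1 + \<tau>) / (\<tau> * \<tau>))"
      using False gold by (intro mult_left_mono) (auto simp: field_simps)
    also have "\<dots> = (1 - 1 / \<tau>) * (1 - (1 + \<tau> - \<tau> * \<tau>) / \<tau>)"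
      using False by (simp add: field_simps power2_eq_square)
    finally show "(1 - \<tau>)\<^sup>2 \<le> (1 - 1 / \<tau>) * (1 - (1 + \<tau> - \<tau> * \<tau>) / \<tau>)" by simp
  qed
qed

text \<open>The form without division includes \<open>p = 0\<close>, which occurs as \<kappa> = 0
  for \<tau> = 1; otherwise multiply by \<open>p\<close> and complete the square.\<close>

lemma young_inequality:
  fixes c p q x y :: real
  assumes "c\<^sup>2 \<le> p * q" "0 \<le> p" "0 \<le> q"
  shows "2 * c * x * y \<le> p * x\<^sup>2 + q * y\<^sup>2"
proof (cases "p = 0")
  case True
  with assms show ?thesis by simp
next
  case False
  then have p: "p > 0" using assms by simp
  have "0 \<le> (p * x - c * y)\<^sup>2 + (p * q - c\<^sup>2) * y\<^sup>2" using assms by simp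
  also have "\<dots> = p * (p * x\<^sup>2 + q * y\<^sup>2 - 2 * c * x * y)"
    by (simp add: power2_eq_square algebra_simps)
  finally show ?thesis using p by (simp add: zero_le_mult_iff)
qed

text \<open>One step of the semi-proximal ADMM with the proximal seminorm \<open>\<Sum>t\<in>T. \<omega> t * (S t)\<^sup>2\<close>. Here \<open>X\<close>, \<open>Y\<close>,
  \<open>S\<close> and \<open>\<mu>\<close> are distances to a KKT point, \<open>b\<close> and \<open>d\<close> are the last increments of \<open>Y\<close> and \<open>S\<close>, and
  \<open>r'\<close> and \<open>d'\<close> are the previous values of \<open>r\<close> and \<open>d\<close>. The three premises on sums come from the
  monotonicity of the subdifferential of the first block, the optimality of the second block, and
  the difference of that optimality condition at two consecutive steps.\<close>

lemma admm_descent: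
  fixes r r' b X Y \<mu> :: "'e \<Rightarrow> real" and S d d' \<omega> :: "'t \<Rightarrow> real"
  assumes \<beta>: "0 < \<beta>" and \<tau>: "0 < \<tau>"
    and w: "0 \<le> \<kappa>" "\<epsilon> \<le> 1" "\<kappa> + \<epsilon> \<le> 2 - \<tau>" "(1 - \<tau>)\<^sup>2 \<le> \<kappa> * (1 - \<epsilon>)"
    and \<omega>: "\<And>t. t \<in> T \<Longrightarrow> 0 \<le> \<omega> t"
    and r: "\<And>e. e \<in> E \<Longrightarrow> r e = X e + Y e"
    and a: "(\<Sum>e\<in>E. X e * (\<mu> e + \<beta> * r e - \<beta> * b e)) \<le> 0"
    and b: "(\<Sum>e\<in>E. Y e * (\<mu> e + \<beta> * r e)) + (\<Sum>t\<in>T. \<omega> t * S t * d t) = 0"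
    and c: "(\<Sum>e\<in>E. b e * (\<beta> * r e - (1 - \<tau>) * \<beta> * r' e)) + (\<Sum>t\<in>T. \<omega> t * d t * (d t - d' t)) = 0"
  shows "(\<Sum>e\<in>E. (\<mu> e + \<tau> * \<beta> * r e)\<^sup>2 / (\<tau> * \<beta>) + \<beta> * (Y e)\<^sup>2) + (\<Sum>t\<in>T. \<omega> t * (S t)\<^sup>2)
      + ((\<Sum>e\<in>E. \<kappa> * \<beta> * (r e)\<^sup>2) + (\<Sum>t\<in>T. \<omega> t * (d t)\<^sup>2))
      + ((\<Sum>e\<in>E. \<epsilon> * \<beta> * ((r e)\<^sup>2 + (b e)\<^sup>2)) + (\<Sum>t\<in>T. \<omega> t * (d t)\<^sup>2))
    \<le> (\<Sum>e\<in>E. (\<mu> e)\<^sup>2 / (\<tau> * \<beta>) + \<beta> * (Y e - b e)\<^sup>2) + (\<Sum>t\<in>T. \<omega> t * (S t - d t)\<^sup>2)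
      + ((\<Sum>e\<in>E. \<kappa> * \<beta> * (r' e)\<^sup>2) + (\<Sum>t\<in>T. \<omega> t * (d' t)\<^sup>2))"
proof -
  \<comment> \<open>The three doubled products on the right are the summands of the premises
    \<open>a\<close>, \<open>b\<close> and \<open>c\<close>. After expansion two estimates remain:
    Young's inequality for the product of \<open>r' e\<close> and \<open>b e\<close>, and the budget
    \<kappa> + \<epsilon> for the square of \<open>r e\<close>.\<close>
  have pe: "(\<mu> e + \<tau> * \<beta> * r e)\<^sup>2 / (\<tau> * \<beta>) + \<beta> * (Y e)\<^sup>2 + \<kappa> * \<beta> * (r e)\<^sup>2
        + \<epsilon> * \<beta> * ((r e)\<^sup>2 + (b e)\<^sup>2)
      \<le> (\<mu> e)\<^sup>2 / (\<tau> * \<beta>) + \<beta> * (Y e - b e)\<^sup>2 + \<kappa> * \<beta> * (r' e)\<^sup>2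
        + 2 * (X e * (\<mu> e + \<beta> * r e - \<beta> * b e)) + 2 * (Y e * (\<mu> e + \<beta> * r e))
        + 2 * (b e * (\<beta> * r e - (1 - \<tau>) * \<beta> * r' e))" (is "?Le e \<le> ?Re e") if e: "e \<in> E" for e
  proof -
    have sq: "(\<mu> e + \<tau> * \<beta> * r e)\<^sup>2 / (\<tau> * \<beta>) = (\<mu> e)\<^sup>2 / (\<tau> * \<beta>) + 2 * \<mu> e * r e + \<tau> * \<beta> * (r e)\<^sup>2"
      using \<beta> \<tau> by (simp add: field_simps power2_eq_square)
    have "2 * (1 - \<tau>) * r' e * b e \<le> \<kappa> * (r' e)\<^sup>2 + (1 - \<epsilon>) * (b e)\<^sup>2"
      using w by (intro young_inequality) auto
    then have y: "\<beta> * (2 * (1 - \<tau>) * r' e * b e) \<le> \<beta> * (\<kappa> * (r' e)\<^sup>2 + (1 - \<epsilon>) * (b e)\<^sup>2)"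
      using \<beta> by (intro mult_left_mono) auto
    have k: "(\<kappa> + \<epsilon>) * (\<beta> * (r e)\<^sup>2) \<le> (2 - \<tau>) * (\<beta> * (r e)\<^sup>2)"
      using w \<beta> by (intro mult_right_mono) auto
    have id: "2 * \<mu> e * r e = 2 * (X e * (\<mu> e + \<beta> * r e - \<beta> * b e)) + 2 * (Y e * (\<mu> e + \<beta> * r e))
        - 2 * \<beta> * (r e)\<^sup>2 + 2 * \<beta> * r e * b e - 2 * \<beta> * Y e * b e"
      unfolding r[OF e] by (simp add: power2_eq_square algebra_simps)
    show ?thesis unfolding sq id using y k by (simp add: power2_eq_square algebra_simps)
  qed
  have pt: "\<omega> t * (S t)\<^sup>2 + \<omega> t * (d t)\<^sup>2 + \<omega> t * (d t)\<^sup>2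
      \<le> \<omega> t * (S t - d t)\<^sup>2 + \<omega> t * (d' t)\<^sup>2 + 2 * (\<omega> t * S t * d t) + 2 * (\<omega> t * d t * (d t - d' t))" (is "?Lt t \<le> ?Rt t")
    if t: "t \<in> T" for t
  proof -
    have "0 \<le> \<omega> t * (d t - d' t)\<^sup>2" using \<omega>[OF t] by simp
    then show ?thesis by (simp add: power2_eq_square algebra_simps)
  qed
  have sums: "sum ?Le E \<le> sum ?Re E" "sum ?Lt T \<le> sum ?Rt T"
    using pe pt by (auto intro: sum_mono)
  show ?thesis
    using sums a b c unfolding sum.distrib sum_distrib_left[of 2, symmetric] by linarith
qed

section \<open>Monotone energies and Fejer monotone sequences in finitely many coordinates\<close>

lemma nonneg_descent_tendsto_0:
  fixes \<Psi> d :: "nat \<Rightarrow> real"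
  assumes "\<And>k. 0 \<le> \<Psi> k" "\<And>k. 0 \<le> d k" "\<And>k. \<Psi> (Suc k) + d k \<le> \<Psi> k"
  shows "d \<longlonglongrightarrow> 0"
proof -
  have "\<Psi> (Suc k) \<le> \<Psi> k" for k using assms(2,3)[of k] by linarith
  then have "decseq \<Psi>" by (rule decseq_SucI)
  then obtain l where l: "\<Psi> \<longlonglongrightarrow> l"
    using decseq_convergent[of \<Psi> 0] assms(1) by blast
  from tendsto_diff[OF l LIMSEQ_Suc[OF l]] have "(\<lambda>k. \<Psi> k - \<Psi> (Suc k)) \<longlonglongrightarrow> 0" by simp
  then show ?thesis
    by (rule tendsto_sandwich[rotated 3, of _ _ _ "\<lambda>_. 0"])
      (use assms in \<open>auto simp: le_diff_eq add.commute\<close>)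
qed

lemma bounded_coordinates_subsequence:
  fixes Z :: "nat \<Rightarrow> 'g \<Rightarrow> real"
  assumes "finite G" "\<And>g. g \<in> G \<Longrightarrow> bounded (range (\<lambda>k. Z k g))"
  shows "\<exists>\<sigma> z. strict_mono (\<sigma> :: nat \<Rightarrow> nat) \<and> (\<forall>g\<in>G. (\<lambda>k. Z (\<sigma> k) g) \<longlonglongrightarrow> z g)"
  using assms
proof (induction G rule: finite_induct)
  case empty
  show ?case by (intro exI[of _ id]) (auto simp: strict_mono_def)
next
  case (insert g G)
  then obtain \<sigma> z where \<sigma>: "strict_mono (\<sigma> :: nat \<Rightarrow> nat)" "\<forall>g\<in>G. (\<lambda>k. Z (\<sigma> k) g) \<longlonglongrightarrow> z g" by auto
  have "bounded (range (\<lambda>k. Z (\<sigma> k) g))"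
    by (rule bounded_subset[OF insert.prems[of g]]) auto
  from bounded_imp_convergent_subsequence[OF this] obtain l \<rho> where
    \<rho>: "strict_mono \<rho>" "((\<lambda>k. Z (\<sigma> k) g) \<circ> \<rho>) \<longlonglongrightarrow> l" by blast
  have "(\<lambda>k. Z (\<sigma> (\<rho> k)) h) \<longlonglongrightarrow> (z(g := l)) h" if "h \<in> insert g G" for h
    using that \<rho> \<sigma>(2) insert.hyps LIMSEQ_subseq_LIMSEQ[OF _ \<rho>(1), of "\<lambda>k. Z (\<sigma> k) h"]
    by (auto simp: o_def)
  moreover have "strict_mono (\<lambda>k. \<sigma> (\<rho> k))"
    using strict_mono_o[OF \<sigma>(1) \<rho>(1)] by (simp add: o_def)
  ultimately show ?case by blast
qed

text \<open>Decrease of the energy towards one target bounds the sequence, so some subsequence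
  converges to a target. The energy towards that target is monotone and tends to 0 along the
  subsequence, hence along the whole sequence. Only coordinates in \<open>G\<close> are controlled,
  so \<open>closed\<close> asks for a target that agrees with the limit there.\<close>

lemma fejer_convergence:
  fixes Z :: "nat \<Rightarrow> 'g \<Rightarrow> real" and h :: "nat \<Rightarrow> real"
  assumes fin: "finite G" and W: "\<And>g. g \<in> G \<Longrightarrow> 0 < W g"
    and h: "\<And>k. 0 \<le> h k" "h \<longlonglongrightarrow> 0"
    and ne: "P z0"
    and fejer: "\<And>z k. P z \<Longrightarrow> (\<Sum>g\<in>G. W g * (Z (Suc k) g - z g)\<^sup>2) + h (Suc k)
        \<le> (\<Sum>g\<in>G. W g * (Z k g - z g)\<^sup>2) + h k"
    and closed: "\<And>\<sigma> z. strict_mono \<sigma> \<Longrightarrow> (\<And>g. g \<in> G \<Longrightarrow> (\<lambda>k. Z (\<sigma> k) g) \<longlonglongrightarrow> z g)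
        \<Longrightarrow> \<exists>z'. P z' \<and> (\<forall>g\<in>G. z' g = z g)"
  obtains z where "P z" "\<And>g. g \<in> G \<Longrightarrow> (\<lambda>k. Z k g) \<longlonglongrightarrow> z g"
proof -
  define \<Phi> where "\<Phi> z k = (\<Sum>g\<in>G. W g * (Z k g - z g)\<^sup>2) + h k" for z k
  have \<Phi>_ge: "W g * (Z k g - z g)\<^sup>2 \<le> \<Phi> z k" if "g \<in> G" for g z k
  proof -
    have "W g * (Z k g - z g)\<^sup>2 \<le> (\<Sum>g\<in>G. W g * (Z k g - z g)\<^sup>2)"
      using fin W that by (intro member_le_sum) (auto simp: less_imp_le)
    then show ?thesis using h(1)[of k] by (simp add: \<Phi>_def)
  qed
  have dec: "decseq (\<Phi> z)" if "P z" for z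
    using fejer[OF that] by (intro decseq_SucI) (simp add: \<Phi>_def)
  have bdd: "bounded (range (\<lambda>k. Z k g))" if g: "g \<in> G" for g
  proof (rule boundedI)
    fix x assume "x \<in> range (\<lambda>k. Z k g)"
    then obtain k where k: "x = Z k g" by blast
    have "W g * (Z k g - z0 g)\<^sup>2 \<le> \<Phi> z0 0"
      using \<Phi>_ge[OF g, of k z0] decseqD[OF dec[OF ne], of 0 k] by simp
    then have "(Z k g - z0 g)\<^sup>2 \<le> \<Phi> z0 0 / W g"
      using W[OF g] by (simp add: field_simps)
    then have "\<bar>Z k g - z0 g\<bar> \<le> sqrt (\<Phi> z0 0 / W g)"
      by (metis real_sqrt_abs real_sqrt_le_mono)
    then show "norm x \<le> sqrt (\<Phi> z0 0 / W g) + \<bar>z0 g\<bar>" unfolding k by simp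
  qed
  have "\<exists>\<sigma> z. strict_mono (\<sigma> :: nat \<Rightarrow> nat) \<and> (\<forall>g\<in>G. (\<lambda>k. Z (\<sigma> k) g) \<longlonglongrightarrow> z g)"
    by (rule bounded_coordinates_subsequence[OF fin]) (rule bdd)
  then obtain \<sigma> z where
    \<sigma>: "strict_mono \<sigma>" "\<And>g. g \<in> G \<Longrightarrow> (\<lambda>k. Z (\<sigma> k) g) \<longlonglongrightarrow> z g" by blast
  from closed[OF this] obtain z' where z': "P z'" "\<And>g. g \<in> G \<Longrightarrow> z' g = z g" by blast
  have \<Phi>_nonneg: "0 \<le> \<Phi> z' k" for k
    unfolding \<Phi>_def using W h(1) by (intro add_nonneg_nonneg sum_nonneg) (auto simp: less_imp_le)
  then obtain l where l: "\<Phi> z' \<longlonglongrightarrow> l"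
    using decseq_convergent[OF dec[OF z'(1)], of 0] by blast
  have "(\<lambda>k. \<Phi> z' (\<sigma> k)) \<longlonglongrightarrow> (\<Sum>g\<in>G. W g * (z' g - z' g)\<^sup>2) + 0"
    unfolding \<Phi>_def using \<sigma>(2) z'(2) LIMSEQ_subseq_LIMSEQ[OF h(2) \<sigma>(1)]
    by (intro tendsto_intros) (auto simp: o_def)
  moreover have "(\<lambda>k. \<Phi> z' (\<sigma> k)) \<longlonglongrightarrow> l"
    using LIMSEQ_subseq_LIMSEQ[OF l \<sigma>(1)] by (simp add: o_def)
  ultimately have "l = 0" using LIMSEQ_unique by fastforce
  with l have \<Phi>0: "\<Phi> z' \<longlonglongrightarrow> 0" by simp
  show ?thesis
  proof (rule that[OF z'(1)])
    fix g assume g: "g \<in> G"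
    have "(\<lambda>k. W g * (Z k g - z' g)\<^sup>2) \<longlonglongrightarrow> 0"
      by (rule tendsto_sandwich[OF _ _ tendsto_const \<Phi>0])
        (use W[OF g] \<Phi>_ge[OF g] in \<open>auto simp: less_imp_le\<close>)
    from tendsto_mult_left[OF this, of "1 / W g"] have "(\<lambda>k. (Z k g - z' g)\<^sup>2) \<longlonglongrightarrow> 0"
      using W[OF g] by simp
    then have "(\<lambda>k. Z k g - z' g) \<longlonglongrightarrow> 0" by (simp add: power_tendsto_0_iff)
    then show "(\<lambda>k. Z k g) \<longlonglongrightarrow> z' g" by (simp add: LIM_zero_iff)
  qed
qed

section \<open>The barycenter problem and its dual\<close>

text \<open>Averages do not exceed the maximum, and a vertex of the simplex attains it.\<close>

lemma conj_simplex_eq_Max: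
  assumes "1 \<le> m"
  shows "conj_simplex m u = ereal (Max (u ` {..<m}))"
  unfolding conj_simplex_def
proof (rule antisym)
  let ?M = "Max (u ` {..<m})"
  show "(SUP w\<in>prob_simplex m. ereal (\<Sum>i<m. u i * w i) - ind_simplex m w) \<le> ereal ?M"
  proof (rule SUP_least)
    fix w assume w: "w \<in> prob_simplex m"
    have "(\<Sum>i<m. u i * w i) \<le> (\<Sum>i<m. ?M * w i)"
      using w by (intro sum_mono mult_right_mono) (auto simp: prob_simplex_def)
    also have "\<dots> = ?M" using w by (simp add: prob_simplex_def flip: sum_distrib_left)
    finally show "ereal (\<Sum>i<m. u i * w i) - ind_simplex m w \<le> ereal ?M"
      using w by (simp add: ind_simplex_def)
  qed
  have "?M \<in> u ` {..<m}" using assms by (intro Max_in) (auto simp: lessThan_empty_iff)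
  then obtain i where i: "i < m" "?M = u i" by auto
  define w where "w j = (if j = i then 1 else 0 :: real)" for j
  have w: "w \<in> prob_simplex m"
    using i by (auto simp: prob_simplex_def vecs_def w_def)
  have "(\<Sum>j<m. u j * w j) = ?M"
    using i by (simp add: w_def if_distrib[of "\<lambda>x. _ * x"] cong: if_cong)
  then show "ereal ?M \<le> (SUP w\<in>prob_simplex m. ereal (\<Sum>i<m. u i * w i) - ind_simplex m w)"
    using w by (intro SUP_upper2[OF w]) (simp add: ind_simplex_def)
qed

lemma ind_nonneg_eq:
  "ind_nonneg N m mt V = (if \<forall>t<N. \<forall>i<m. \<forall>j<mt t. 0 \<le> V t i j then 0 else \<infinity>)"
  unfolding ind_nonneg_def by (auto simp: sum_Pinfty)

lemma sum_nonneg_le_0_imp_0: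
  fixes f :: "'a \<Rightarrow> real"
  assumes "finite A" "\<And>x. x \<in> A \<Longrightarrow> 0 \<le> f x" "sum f A \<le> 0" "x \<in> A"
  shows "f x = 0"
  using assms sum_nonneg[of A f] sum_nonneg_eq_0_iff[of A f] by force

lemma sum_blocks_nonneg_le_0_imp_0:
  fixes f :: "nat \<Rightarrow> nat \<Rightarrow> real"
  assumes "\<And>t j. t < N \<Longrightarrow> j < n t \<Longrightarrow> 0 \<le> f t j" "(\<Sum>t<N. \<Sum>j<n t. f t j) \<le> 0" "t < N" "j < n t"
  shows "f t j = 0"
proof -
  have "(\<Sum>j<n t. f t j) = 0"
    by (rule sum_nonneg_le_0_imp_0[OF _ _ assms(2)]) (use assms in \<open>auto intro: sum_nonneg\<close>)
  then show ?thesis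
    by (intro sum_nonneg_le_0_imp_0[of "{..<n t}" "f t"]) (use assms in auto)
qed

lemma sum_blocks3_nonneg_le_0_imp_0:
  fixes f :: "nat \<Rightarrow> nat \<Rightarrow> nat \<Rightarrow> real"
  assumes "\<And>t i j. t < N \<Longrightarrow> i < m \<Longrightarrow> j < n t \<Longrightarrow> 0 \<le> f t i j"
    "(\<Sum>t<N. \<Sum>i<m. \<Sum>j<n t. f t i j) \<le> 0" "t < N" "i < m" "j < n t"
  shows "f t i j = 0"
proof -
  have "(\<Sum>j<n t. f t i j) = 0"
    by (rule sum_blocks_nonneg_le_0_imp_0[OF _ assms(2)]) (use assms in \<open>auto intro: sum_nonneg\<close>)
  then show ?thesis
    by (intro sum_nonneg_le_0_imp_0[of "{..<n t}" "f t i"]) (use assms in auto)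
qed

text \<open>First-order optimality along a ray: divide by \<open>s\<close> and let it tend to 0. The
  range stops at 1 because perturbations of the first block run along a segment, on which convexity
  and nonnegativity are available.\<close>

lemma nonneg_linear_coeff:
  fixes A C :: real
  assumes "\<And>s. 0 < s \<Longrightarrow> s \<le> 1 \<Longrightarrow> 0 \<le> s * A + s\<^sup>2 * C"
  shows "0 \<le> A"
proof (rule tendsto_lowerbound[where F = "at_right (0::real)" and f = "\<lambda>s. A + s * C"])
  have "((\<lambda>s. A + s * C) \<longlongrightarrow> A + 0 * C) (at_right 0)" by (intro tendsto_intros)
  then show "((\<lambda>s. A + s * C) \<longlongrightarrow> A) (at_right 0)" by simp
  have "0 \<le> A + s * C" if "0 < s" "s < 1" for s
  proof -
    have "0 \<le> s * (A + s * C)" using assms[of s] that by (simp add: power2_eq_square algebra_simps)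
    then show ?thesis using that by (simp add: zero_le_mult_iff)
  qed
  then show "\<forall>\<^sub>F s in at_right 0. 0 \<le> A + s * C"
    unfolding eventually_at_right_field by (intro exI[of _ 1]) auto
qed simp

section \<open>The quadratic part of the augmented Lagrangian\<close>

definition AL_smooth where
  "AL_smooth N m mt a D \<beta> u V y z lam Lam =
      (\<Sum>t<N. \<Sum>j<mt t. z t j * a t j)
       + (\<Sum>i<m. lam i * ((\<Sum>t<N. y t i) - u i))
       + (\<Sum>t<N. \<Sum>i<m. \<Sum>j<mt t. Lam t i j * resid D V y z t i j)
       + \<beta> / 2 * (\<Sum>i<m. ((\<Sum>t<N. y t i) - u i)^2)
       + \<beta> / 2 * (\<Sum>t<N. \<Sum>i<m. \<Sum>j<mt t. (resid D V y z t i j)^2)"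

lemma AL_smooth_expand:
  "AL_smooth N m mt a D \<beta> (\<lambda>i. u i + s * du i) (\<lambda>t i j. V t i j + s * dV t i j)
      (\<lambda>t i. y t i + s * dy t i) (\<lambda>t j. z t j + s * dz t j) lam Lam
   = AL_smooth N m mt a D \<beta> u V y z lam Lam
     + s * ((\<Sum>t<N. \<Sum>j<mt t. dz t j * a t j)
       + (\<Sum>i<m. (lam i + \<beta> * ((\<Sum>t<N. y t i) - u i)) * ((\<Sum>t<N. dy t i) - du i))
       + (\<Sum>t<N. \<Sum>i<m. \<Sum>j<mt t. (Lam t i j + \<beta> * resid D V y z t i j) * (dV t i j - dy t i - dz t j)))
     + s\<^sup>2 * (\<beta> / 2 * (\<Sum>i<m. ((\<Sum>t<N. dy t i) - du i)\<^sup>2)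
       + \<beta> / 2 * (\<Sum>t<N. \<Sum>i<m. \<Sum>j<mt t. (dV t i j - dy t i - dz t j)\<^sup>2))"
proof -
  define p dp where "p i = (\<Sum>t<N. y t i) - u i" and "dp i = (\<Sum>t<N. dy t i) - du i" for i
  define R dR where "R t i j = resid D V y z t i j" and "dR t i j = dV t i j - dy t i - dz t j" for t i j
  have 1: "(\<Sum>t<N. y t i + s * dy t i) - (u i + s * du i) = p i + s * dp i" for i
    unfolding p_def dp_def by (simp add: sum.distrib sum_distrib_left right_diff_distrib)
  have 2: "resid D (\<lambda>t i j. V t i j + s * dV t i j) (\<lambda>t i. y t i + s * dy t i)
      (\<lambda>t j. z t j + s * dz t j) t i j = R t i j + s * dR t i j" for t i j
    by (simp add: resid_def R_def dR_def algebra_simps)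
  have lin: "(\<Sum>t<N. \<Sum>j<mt t. (z t j + s * dz t j) * a t j)
      = (\<Sum>t<N. \<Sum>j<mt t. z t j * a t j) + s * (\<Sum>t<N. \<Sum>j<mt t. dz t j * a t j)"
    by (simp add: sum.distrib sum_distrib_left algebra_simps)
  have P: "(\<Sum>i<m. lam i * (p i + s * dp i)) + \<beta> / 2 * (\<Sum>i<m. (p i + s * dp i)\<^sup>2)
      = (\<Sum>i<m. lam i * p i) + \<beta> / 2 * (\<Sum>i<m. (p i)\<^sup>2) + s * (\<Sum>i<m. (lam i + \<beta> * p i) * dp i)
        + s\<^sup>2 * (\<beta> / 2 * (\<Sum>i<m. (dp i)\<^sup>2))"
    unfolding sum_distrib_left sum.distrib[symmetric]
    by (rule sum.cong) (auto simp: power2_eq_square algebra_simps)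
  have Q: "(\<Sum>t<N. \<Sum>i<m. \<Sum>j<mt t. Lam t i j * (R t i j + s * dR t i j))
        + \<beta> / 2 * (\<Sum>t<N. \<Sum>i<m. \<Sum>j<mt t. (R t i j + s * dR t i j)\<^sup>2)
      = (\<Sum>t<N. \<Sum>i<m. \<Sum>j<mt t. Lam t i j * R t i j) + \<beta> / 2 * (\<Sum>t<N. \<Sum>i<m. \<Sum>j<mt t. (R t i j)\<^sup>2)
        + s * (\<Sum>t<N. \<Sum>i<m. \<Sum>j<mt t. (Lam t i j + \<beta> * R t i j) * dR t i j)
        + s\<^sup>2 * (\<beta> / 2 * (\<Sum>t<N. \<Sum>i<m. \<Sum>j<mt t. (dR t i j)\<^sup>2))"
    unfolding sum_distrib_left sum.distrib[symmetric]
    by (intro sum.cong) (auto simp: power2_eq_square algebra_simps)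
  show ?thesis
    unfolding AL_smooth_def 1 2 lin p_def[symmetric] dp_def[symmetric] R_def[symmetric] dR_def[symmetric]
    using P Q unfolding distrib_left[of s] distrib_left[of "s\<^sup>2"] by linarith
qed

lemma sum_eq_single:
  fixes f :: "'a \<Rightarrow> real"
  assumes "finite A" "x \<in> A" "\<And>y. y \<in> A \<Longrightarrow> y \<noteq> x \<Longrightarrow> f y = 0"
  shows "sum f A = f x"
  using assms by (simp add: sum.remove[of A x])

locale barycenter =
  fixes N m :: nat and mt :: "nat \<Rightarrow> nat"
    and D :: "nat \<Rightarrow> nat \<Rightarrow> nat \<Rightarrow> real" and a :: "nat \<Rightarrow> nat \<Rightarrow> real"
  assumes N: "1 \<le> N" and m: "1 \<le> m" and mt: "t < N \<Longrightarrow> 1 \<le> mt t"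
    and a_nonneg: "t < N \<Longrightarrow> j < mt t \<Longrightarrow> 0 \<le> a t j"
    and a_sum: "t < N \<Longrightarrow> (\<Sum>j<mt t. a t j) = 1"
begin

lemma AL_eq:
  "AL N m mt a D \<beta> u V y z lam Lam =
    (if \<forall>t<N. \<forall>i<m. \<forall>j<mt t. 0 \<le> V t i j
     then ereal (Max (u ` {..<m}) + AL_smooth N m mt a D \<beta> u V y z lam Lam) else \<infinity>)"
  unfolding AL_def AL_smooth_def conj_simplex_eq_Max[OF m] ind_nonneg_eq by simp

lemma le_Max: "i < m \<Longrightarrow> u i \<le> Max (u ` {..<m})"
  by simp

lemma Max_le_iff': "Max (u ` {..<m}) \<le> (c :: real) \<longleftrightarrow> (\<forall>i<m. u i \<le> c)"
  using m by (subst Max_le_iff) (auto simp: lessThan_empty_iff)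

text \<open>The last clause says that the maximum of \<open>u\<close> is at most the pairing of
  \<open>w\<close> and \<open>u\<close>, so that \<open>w\<close> is a subgradient of the maximum at
  \<open>u\<close>. That \<open>w\<close> lies in the simplex follows from the other clauses, by
  \<open>P_feas_prob_simplex\<close>.\<close>

definition KKT where
  "KKT u V y z w P \<longleftrightarrow> D_feas N m mt D u V y z \<and> P_feas N m mt a w P
     \<and> (\<forall>t<N. \<forall>i<m. \<forall>j<mt t. 0 \<le> V t i j \<and> 0 \<le> P t i j \<and> V t i j * P t i j = 0)
     \<and> (\<forall>i<m. u i \<le> (\<Sum>i<m. w i * u i))"

text \<open>Substitute the dual equation for \<open>V\<close> and sum: the row sums of
  \<open>P\<close> turn the \<open>y\<close> terms into the pairing of \<open>w\<close> and
  \<open>u\<close>, the column sums turn the \<open>z\<close> terms into the pairing with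
  \<open>a\<close>. The right-hand side is thus the duality gap as long as the maximum of
  \<open>u\<close> is replaced by its average under \<open>w\<close>.\<close>

lemma duality_gap_identity:
  assumes "D_feas N m mt D u V y z" "P_feas N m mt a w P"
  shows "(\<Sum>t<N. \<Sum>i<m. \<Sum>j<mt t. D t i j * P t i j) + (\<Sum>i<m. w i * u i)
      + (\<Sum>t<N. \<Sum>j<mt t. z t j * a t j) = (\<Sum>t<N. \<Sum>i<m. \<Sum>j<mt t. V t i j * P t i j)"
proof -
  have u: "u i = (\<Sum>t<N. y t i)" if "i < m" for i
    using assms(1) that unfolding D_feas_def by auto
  have V: "V t i j = D t i j + y t i + z t j" if "t < N" "i < m" "j < mt t" for t i j
  proof -
    have "resid D V y z t i j = 0" using assms(1) that unfolding D_feas_def by blast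
    then show ?thesis by (simp add: resid_def)
  qed
  have w: "w i = (\<Sum>j<mt t. P t i j)" if "t < N" "i < m" for t i
    using assms(2) that unfolding P_feas_def by simp
  have a: "a t j = (\<Sum>i<m. P t i j)" if "t < N" "j < mt t" for t j
    using assms(2) that unfolding P_feas_def by simp
  have 1: "(\<Sum>i<m. w i * u i) = (\<Sum>t<N. \<Sum>i<m. \<Sum>j<mt t. y t i * P t i j)"
  proof -
    have "(\<Sum>i<m. w i * u i) = (\<Sum>i<m. \<Sum>t<N. y t i * w i)"
      by (intro sum.cong) (auto simp: u sum_distrib_left sum_distrib_right mult.commute)
    also have "\<dots> = (\<Sum>t<N. \<Sum>i<m. y t i * w i)" by (rule sum.swap)
    also have "\<dots> = (\<Sum>t<N. \<Sum>i<m. \<Sum>j<mt t. y t i * P t i j)"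
    proof (intro sum.cong refl)
      fix t i assume "t \<in> {..<N}" "i \<in> {..<m}"
      then show "y t i * w i = (\<Sum>j<mt t. y t i * P t i j)"
        by (simp add: w[of t] sum_distrib_left)
    qed
    finally show ?thesis .
  qed
  have 2: "(\<Sum>t<N. \<Sum>j<mt t. z t j * a t j) = (\<Sum>t<N. \<Sum>i<m. \<Sum>j<mt t. z t j * P t i j)"
  proof (rule sum.cong[OF refl])
    fix t assume t: "t \<in> {..<N}"
    have "(\<Sum>j<mt t. z t j * a t j) = (\<Sum>j<mt t. \<Sum>i<m. z t j * P t i j)"
      using t by (intro sum.cong) (auto simp: a sum_distrib_left)
    also have "\<dots> = (\<Sum>i<m. \<Sum>j<mt t. z t j * P t i j)" by (rule sum.swap)
    finally show "(\<Sum>j<mt t. z t j * a t j) = (\<Sum>i<m. \<Sum>j<mt t. z t j * P t i j)" .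
  qed
  show ?thesis unfolding 1 2 sum.distrib[symmetric]
    by (intro sum.cong) (auto simp: V algebra_simps)
qed

lemma weak_duality:
  assumes "D_feas N m mt D u V y z" "P_feas N m mt a w P" "w \<in> prob_simplex m"
    and "\<And>t i j. t < N \<Longrightarrow> i < m \<Longrightarrow> j < mt t \<Longrightarrow> 0 \<le> V t i j"
    and "\<And>t i j. t < N \<Longrightarrow> i < m \<Longrightarrow> j < mt t \<Longrightarrow> 0 \<le> P t i j"
  shows "- (Max (u ` {..<m}) + (\<Sum>t<N. \<Sum>j<mt t. z t j * a t j))
      \<le> (\<Sum>t<N. \<Sum>i<m. \<Sum>j<mt t. D t i j * P t i j)"
proof -
  have "0 \<le> (\<Sum>t<N. \<Sum>i<m. \<Sum>j<mt t. V t i j * P t i j)"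
    using assms(4,5) by (intro sum_nonneg) auto
  moreover have "(\<Sum>i<m. w i * u i) \<le> (\<Sum>i<m. w i * Max (u ` {..<m}))"
    using assms(3) by (intro sum_mono mult_left_mono) (auto simp: prob_simplex_def)
  moreover have "\<dots> = Max (u ` {..<m})"
    using assms(3) by (simp add: prob_simplex_def flip: sum_distrib_right)
  ultimately show ?thesis using duality_gap_identity[OF assms(1,2)] by simp
qed

text \<open>Count the mass of block 0 by rows and by columns.\<close>

lemma P_feas_prob_simplex:
  assumes "P_feas N m mt a w P" "\<And>t i j. t < N \<Longrightarrow> i < m \<Longrightarrow> j < mt t \<Longrightarrow> 0 \<le> P t i j"
  shows "w \<in> prob_simplex m"
proof -
  have w: "w i = (\<Sum>j<mt 0. P 0 i j)" if "i < m" for i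
    using assms(1) N that unfolding P_feas_def by simp
  have "(\<Sum>i<m. w i) = (\<Sum>i<m. \<Sum>j<mt 0. P 0 i j)" by (simp add: w)
  also have "\<dots> = (\<Sum>j<mt 0. \<Sum>i<m. P 0 i j)" by (rule sum.swap)
  also have "\<dots> = (\<Sum>j<mt 0. a 0 j)" using assms(1) N unfolding P_feas_def by (intro sum.cong) auto
  also have "\<dots> = 1" using a_sum N by simp
  finally have "(\<Sum>i<m. w i) = 1" .
  moreover have "0 \<le> w i" if "i < m" for i
    unfolding w[OF that] using assms(2) N that by (intro sum_nonneg) auto
  ultimately show ?thesis using assms(1) by (simp add: prob_simplex_def P_feas_def)
qed

lemma KKT_optimal:
  assumes "KKT u V y z w P"
  shows "D_optimal N m mt a D u V y z" "P_optimal N m mt a D w P"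
proof -
  have feas: "D_feas N m mt D u V y z" "P_feas N m mt a w P"
    and V: "\<And>t i j. t < N \<Longrightarrow> i < m \<Longrightarrow> j < mt t \<Longrightarrow> 0 \<le> V t i j"
    and P: "\<And>t i j. t < N \<Longrightarrow> i < m \<Longrightarrow> j < mt t \<Longrightarrow> 0 \<le> P t i j"
    and comp: "\<And>t i j. t < N \<Longrightarrow> i < m \<Longrightarrow> j < mt t \<Longrightarrow> V t i j * P t i j = 0"
    and u: "Max (u ` {..<m}) \<le> (\<Sum>i<m. w i * u i)"
    using assms unfolding KKT_def Max_le_iff' by blast+
  have w: "w \<in> prob_simplex m" by (rule P_feas_prob_simplex[OF feas(2) P])
  have "(\<Sum>t<N. \<Sum>i<m. \<Sum>j<mt t. V t i j * P t i j) = 0"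
    by (intro sum.neutral ballI) (auto simp: comp)
  with duality_gap_identity[OF feas] u
  have eq: "(\<Sum>t<N. \<Sum>i<m. \<Sum>j<mt t. D t i j * P t i j)
      \<le> - (Max (u ` {..<m}) + (\<Sum>t<N. \<Sum>j<mt t. z t j * a t j))" by simp
  show "D_optimal N m mt a D u V y z"
    unfolding D_optimal_def
  proof (intro conjI allI impI feas)
    fix u' V' y' z' assume "D_feas N m mt D u' V' y' z'"
    from weak_duality[OF this feas(2) w _ P] eq
    show "D_obj N m mt a u V z \<le> D_obj N m mt a u' V' z'"
      using V by (auto simp: D_obj_def conj_simplex_eq_Max[OF m] ind_nonneg_eq)
  qed
  show "P_optimal N m mt a D w P"
    unfolding P_optimal_def
  proof (intro conjI allI impI feas)
    fix w' P' assume "P_feas N m mt a w' P'"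
    from weak_duality[OF feas(1) this _ V] eq
    show "P_obj N m mt D w P \<le> P_obj N m mt D w' P'"
      using P w by (auto simp: P_obj_def ind_simplex_def ind_nonneg_eq)
  qed
qed

section \<open>Existence of a KKT point\<close>

definition cells :: "(nat \<times> nat \<times> nat) set" where
  "cells = (SIGMA t:{..<N}. {..<m} \<times> {..<mt t})"

lemma finite_cells [simp]: "finite cells"
  by (simp add: cells_def)

lemma mem_cells [simp]: "(t, i, j) \<in> cells \<longleftrightarrow> t < N \<and> i < m \<and> j < mt t"
  by (simp add: cells_def)

lemma sum_cells: "sum f cells = (\<Sum>t<N. \<Sum>i<m. \<Sum>j<mt t. f (t, i, j))"
  unfolding cells_def by (simp add: sum.Sigma sum.cartesian_product split_def)

lemma sum_constraints:
  "sum f ({..<m} <+> cells) = (\<Sum>i<m. f (Inl i)) + (\<Sum>t<N. \<Sum>i<m. \<Sum>j<mt t. f (Inr (t, i, j)))"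
  by (simp add: sum.Plus sum_cells)

text \<open>(D) is a linear program in \<open>y\<close> (\<open>Inl\<close>), \<open>z\<close> (\<open>Inr \<circ> Inl\<close>) and an upper bound \<open>\<theta>\<close> of
  \<open>u\<close> (\<open>Inr \<circ> Inr\<close>), with constraints \<open>\<theta> \<ge> u i\<close> (\<open>Inl i\<close>) and \<open>V t i j \<ge> 0\<close> (\<open>Inr (t, i, j)\<close>).\<close>

lemma KKT_exists: "\<exists>u V y z w P. KKT u V y z w P"
proof -
  define A :: "nat + nat \<times> nat \<times> nat \<Rightarrow> (nat \<times> nat) + (nat \<times> nat) + unit \<Rightarrow> real" where
    "A = case_sum
      (\<lambda>i. case_sum (\<lambda>(t', i'). if i' = i then - 1 else 0) (case_sum (\<lambda>_. 0) (\<lambda>_. 1)))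
      (\<lambda>(t, i, j). case_sum (\<lambda>(t', i'). if t' = t \<and> i' = i then 1 else 0)
        (case_sum (\<lambda>(t', j'). if t' = t \<and> j' = j then 1 else 0) (\<lambda>_. 0)))"
  define b where "b = case_sum (\<lambda>i::nat. 0) (\<lambda>(t, i, j). - D t i j)"
  define c where "c = case_sum (\<lambda>_::nat \<times> nat. 0) (case_sum (\<lambda>(t, j). a t j) (\<lambda>_::unit. 1))"
  define I where "I = {..<m} <+> cells"
  define J where "J = ({..<N} \<times> {..<m}) <+> (SIGMA t:{..<N}. {..<mt t}) <+> {()}"
  have J: "sum f J = (\<Sum>t<N. \<Sum>i<m. f (Inl (t, i))) + ((\<Sum>t<N. \<Sum>j<mt t. f (Inr (Inl (t, j)))) + f (Inr (Inr ())))"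
    for f :: "_ \<Rightarrow> real"
    by (simp add: J_def sum.Plus sum.Sigma sum.cartesian_product)
  have Al: "(\<Sum>j\<in>J. A (Inl i) j * x j) = x (Inr (Inr ())) - (\<Sum>t<N. x (Inl (t, i)))" if "i < m" for i x
  proof -
    have "(\<Sum>i'<m. A (Inl i) (Inl (t, i')) * x (Inl (t, i'))) = - x (Inl (t, i))" for t
      using that by (subst sum_eq_single[of _ i]) (auto simp: A_def)
    then show ?thesis unfolding J by (simp add: A_def sum_negf)
  qed
  have Ar: "(\<Sum>v\<in>J. A (Inr (t, i, j)) v * x v) = x (Inl (t, i)) + x (Inr (Inl (t, j)))"
    if "t < N" "i < m" "j < mt t" for t i j x
  proof -
    have "(\<Sum>t'<N. \<Sum>i'<m. A (Inr (t, i, j)) (Inl (t', i')) * x (Inl (t', i')))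
        = (\<Sum>i'<m. A (Inr (t, i, j)) (Inl (t, i')) * x (Inl (t, i')))"
      using that by (intro sum_eq_single) (auto simp: A_def)
    also have "\<dots> = x (Inl (t, i))"
      using that by (subst sum_eq_single[of _ i]) (auto simp: A_def)
    finally have 1: "(\<Sum>t'<N. \<Sum>i'<m. A (Inr (t, i, j)) (Inl (t', i')) * x (Inl (t', i'))) = x (Inl (t, i))" .
    have "(\<Sum>t'<N. \<Sum>j'<mt t'. A (Inr (t, i, j)) (Inr (Inl (t', j'))) * x (Inr (Inl (t', j'))))
        = (\<Sum>j'<mt t. A (Inr (t, i, j)) (Inr (Inl (t, j'))) * x (Inr (Inl (t, j'))))"
      using that by (intro sum_eq_single) (auto simp: A_def)
    also have "\<dots> = x (Inr (Inl (t, j)))"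
      using that by (subst sum_eq_single[of _ j]) (auto simp: A_def)
    finally show ?thesis unfolding J 1 by (simp add: A_def)
  qed
  \<comment> \<open>With \<open>l\<close> read as \<open>w\<close> on \<open>Inl\<close> and as the
    transport plans on \<open>Inr\<close>, the column equations \<open>Ay\<close>, \<open>Az\<close>
    and \<open>At\<close> become the row marginals, the column marginals and total mass 1.\<close>
  have Ay: "(\<Sum>e\<in>I. l e * A e (Inl (t, i))) = (\<Sum>j<mt t. l (Inr (t, i, j))) - l (Inl i)"
    if "t < N" "i < m" for l t i
  proof -
    have "(\<Sum>t'<N. \<Sum>i'<m. \<Sum>j<mt t'. l (Inr (t', i', j)) * A (Inr (t', i', j)) (Inl (t, i)))
        = (\<Sum>i'<m. \<Sum>j<mt t. l (Inr (t, i', j)) * A (Inr (t, i', j)) (Inl (t, i)))"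
      using that by (intro sum_eq_single) (auto simp: A_def)
    also have "\<dots> = (\<Sum>j<mt t. l (Inr (t, i, j)))"
      using that by (subst sum_eq_single[of _ i]) (auto simp: A_def)
    finally have 1: "(\<Sum>t'<N. \<Sum>i'<m. \<Sum>j<mt t'. l (Inr (t', i', j)) * A (Inr (t', i', j)) (Inl (t, i)))
        = (\<Sum>j<mt t. l (Inr (t, i, j)))" .
    have 2: "(\<Sum>i'<m. l (Inl i') * A (Inl i') (Inl (t, i))) = - l (Inl i)"
      using that by (subst sum_eq_single[of _ i]) (auto simp: A_def)
    show ?thesis unfolding I_def sum_constraints 1 2 by simp
  qed
  have Az: "(\<Sum>e\<in>I. l e * A e (Inr (Inl (t, j)))) = (\<Sum>i<m. l (Inr (t, i, j)))"
    if "t < N" "j < mt t" for l t j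
  proof -
    have "(\<Sum>t'<N. \<Sum>i<m. \<Sum>j'<mt t'. l (Inr (t', i, j')) * A (Inr (t', i, j')) (Inr (Inl (t, j))))
        = (\<Sum>i<m. \<Sum>j'<mt t. l (Inr (t, i, j')) * A (Inr (t, i, j')) (Inr (Inl (t, j))))"
      using that by (intro sum_eq_single) (auto simp: A_def)
    also have "\<dots> = (\<Sum>i<m. l (Inr (t, i, j)))"
      using that by (intro sum.cong refl, subst sum_eq_single[of _ j]) (auto simp: A_def)
    finally show ?thesis unfolding I_def sum_constraints by (simp add: A_def)
  qed
  have At: "(\<Sum>e\<in>I. l e * A e (Inr (Inr ()))) = (\<Sum>i<m. l (Inl i))" for l
    unfolding I_def sum_constraints by (simp add: A_def)
  \<comment> \<open>Feasible points on both sides: \<open>y\<close> and \<theta> zero with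
    \<open>z\<close> large enough to outweigh \<open>D\<close>, and the product coupling of uniform
    weights with \<open>a\<close>.\<close>
  define x0 where "x0 = case_sum (\<lambda>_::nat \<times> nat. 0 :: real)
    (case_sum (\<lambda>(t, j). \<Sum>i<m. \<bar>D t i j\<bar>) (\<lambda>_::unit. 0))"
  define l0 where "l0 = case_sum (\<lambda>_::nat. 1 / real m) (\<lambda>(t, i::nat, j). a t j / m)"
  have "b e \<le> (\<Sum>j\<in>J. A e j * x0 j)" if "e \<in> I" for e
  proof (cases e)
    case (Inl i)
    with that have "i < m" by (auto simp: I_def)
    then show ?thesis unfolding Inl Al[OF \<open>i < m\<close>] by (simp add: b_def x0_def)
  next
    case (Inr p)
    moreover obtain t i j where "p = (t, i, j)" by (cases p)
    ultimately have p: "e = Inr (t, i, j)" "t < N" "i < m" "j < mt t"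
      using that by (auto simp: I_def)
    have "\<bar>D t i j\<bar> \<le> (\<Sum>i<m. \<bar>D t i j\<bar>)" using p by (intro member_le_sum) auto
    then show ?thesis unfolding p(1) Ar[OF p(2-)] by (simp add: b_def x0_def)
  qed
  moreover have "0 \<le> l0 e" if "e \<in> I" for e
    using that a_nonneg by (auto simp: I_def l0_def)
  moreover have "(\<Sum>e\<in>I. l0 e * A e j) = c j" if "j \<in> J" for j
    using that m
    by (auto simp: J_def Ay Az At l0_def c_def a_sum simp flip: sum_divide_distrib)
  moreover have "finite I" "finite J" by (auto simp: I_def J_def)
  ultimately obtain x l where x: "\<And>e. e \<in> I \<Longrightarrow> b e \<le> (\<Sum>j\<in>J. A e j * x j)"
    and l: "\<And>e. e \<in> I \<Longrightarrow> 0 \<le> l e" "\<And>j. j \<in> J \<Longrightarrow> (\<Sum>e\<in>I. l e * A e j) = c j"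
    and gap: "(\<Sum>j\<in>J. c j * x j) \<le> (\<Sum>e\<in>I. b e * l e)"
    using lp_strong_duality[of I J b A x0 l0 c] by blast
  define y where "y t i = (if t < N \<and> i < m then x (Inl (t, i)) else 0)" for t i
  define z where "z t j = (if t < N \<and> j < mt t then x (Inr (Inl (t, j))) else 0)" for t j
  define \<theta> where "\<theta> = x (Inr (Inr ()))"
  define u where "u i = (\<Sum>t<N. y t i)" for i
  define V where "V t i j = (if t < N \<and> i < m \<and> j < mt t then D t i j + y t i + z t j else 0)" for t i j
  define w where "w i = (if i < m then l (Inl i) else 0)" for i
  define P where "P t i j = (if t < N \<and> i < m \<and> j < mt t then l (Inr (t, i, j)) else 0)" for t i j
  have D: "D_feas N m mt D u V y z"
    by (auto simp: D_feas_def vecs_def famMat_def famVec_def famVecT_def resid_def u_def V_def y_def z_def)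
  have Pm: "(\<Sum>j<mt t. P t i j) = w i" if "t < N" "i < m" for t i
    using l(2)[of "Inl (t, i)"] that by (simp add: J_def InlI Ay c_def P_def w_def)
  have Pa: "(\<Sum>i<m. P t i j) = a t j" if "t < N" "j < mt t" for t j
    using l(2)[of "Inr (Inl (t, j))"] that by (simp add: J_def InlI InrI Az c_def P_def)
  have P: "P_feas N m mt a w P"
    unfolding P_feas_def using Pm Pa by (auto simp: vecs_def famMat_def w_def P_def)
  have w1: "(\<Sum>i<m. w i) = 1"
    using l(2)[of "Inr (Inr ())"] by (simp add: J_def InrI At c_def w_def)
  have w0: "0 \<le> w i" if "i < m" for i
    using l(1)[of "Inl i"] that by (simp add: I_def w_def InlI)
  have P0: "0 \<le> P t i j" if "t < N" "i < m" "j < mt t" for t i j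
    using l(1)[of "Inr (t, i, j)"] that by (simp add: I_def P_def InrI)
  have u\<theta>: "u i \<le> \<theta>" if "i < m" for i
    using x[of "Inl i"] that by (simp add: I_def InlI Al b_def u_def y_def \<theta>_def)
  have V0: "0 \<le> V t i j" if "t < N" "i < m" "j < mt t" for t i j
    using x[of "Inr (t, i, j)"] that by (simp add: I_def InrI Ar b_def V_def y_def z_def)
  have "(\<Sum>j\<in>J. c j * x j) = (\<Sum>t<N. \<Sum>j<mt t. z t j * a t j) + \<theta>"
    unfolding J by (simp add: c_def z_def \<theta>_def mult.commute)
  moreover have "(\<Sum>e\<in>I. b e * l e) = - (\<Sum>t<N. \<Sum>i<m. \<Sum>j<mt t. D t i j * P t i j)"
    unfolding I_def sum_constraints by (simp add: b_def P_def sum_negf)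
  \<comment> \<open>Since the average of \<open>u\<close> under \<open>w\<close> is at most
    \<theta>, this squeezes both unknowns: the pairing of \<open>V\<close> and \<open>P\<close> is
    0, and \<theta> equals the average.\<close>
  ultimately have gap': "(\<Sum>t<N. \<Sum>i<m. \<Sum>j<mt t. V t i j * P t i j) + \<theta> \<le> (\<Sum>i<m. w i * u i)"
    using gap duality_gap_identity[OF D P] by simp
  have "(\<Sum>i<m. w i * u i) \<le> (\<Sum>i<m. w i * \<theta>)"
    using w0 u\<theta> by (intro sum_mono mult_left_mono) auto
  also have "\<dots> = \<theta>" using w1 by (simp flip: sum_distrib_right)
  finally have *: "(\<Sum>t<N. \<Sum>i<m. \<Sum>j<mt t. V t i j * P t i j) \<le> 0" using gap' by simp
  have VP: "V t i j * P t i j = 0" if "t < N" "i < m" "j < mt t" for t i j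
    by (rule sum_blocks3_nonneg_le_0_imp_0[OF _ * that]) (simp add: V0 P0)
  have "0 \<le> (\<Sum>t<N. \<Sum>i<m. \<Sum>j<mt t. V t i j * P t i j)"
    using V0 P0 by (intro sum_nonneg) auto
  then have "\<theta> \<le> (\<Sum>i<m. w i * u i)" using gap' by simp
  then have "u i \<le> (\<Sum>i<m. w i * u i)" if "i < m" for i
    using u\<theta>[OF that] by simp
  then have "KKT u V y z w P"
    unfolding KKT_def using D P VP V0 P0 by blast
  then show ?thesis by blast
qed

section \<open>Optimality conditions of the subproblems\<close>

text \<open>Nonnegativity of \<open>V\<close> makes the value finite, so the problem in
  \<open>z\<close> is smooth and unconstrained up to the index range; its gradient vanishes.\<close>

lemma arg_min_z_stationary:
  assumes "is_arg_min (\<lambda>z'. AL N m mt a D \<beta> u V y z' lam Lam) (\<lambda>z'. z' \<in> famVecT N mt) z"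
    and V: "\<forall>t<N. \<forall>i<m. \<forall>j<mt t. 0 \<le> V t i j" and "t < N" "j < mt t"
  shows "a t j = (\<Sum>i<m. Lam t i j + \<beta> * resid D V y z t i j)"
proof -
  let ?M = "\<lambda>t i j. Lam t i j + \<beta> * resid D V y z t i j"
  define c where "c t j = a t j - (\<Sum>i<m. ?M t i j)" for t j
  \<comment> \<open>The negative gradient, cut off so that the perturbed point stays in
    \<open>famVecT N mt\<close>. Along it the derivative is minus a sum of squares, yet
    nonnegative.\<close>
  define dz where "dz t j = (if t < N \<and> j < mt t then - c t j else 0)" for t j
  have z: "z \<in> famVecT N mt" using assms(1) by (simp add: is_arg_min_def)
  have "0 \<le> (\<Sum>t<N. \<Sum>j<mt t. dz t j * a t j)
      + (\<Sum>t<N. \<Sum>i<m. \<Sum>j<mt t. ?M t i j * - dz t j)" (is "0 \<le> ?L")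
  proof (rule nonneg_linear_coeff)
    fix s :: real
    have "(\<lambda>t j. z t j + s * dz t j) \<in> famVecT N mt" using z by (auto simp: famVecT_def dz_def)
    then have "AL_smooth N m mt a D \<beta> u V y z lam Lam
        \<le> AL_smooth N m mt a D \<beta> u V y (\<lambda>t j. z t j + s * dz t j) lam Lam"
      using assms(1) V unfolding is_arg_min_def AL_eq by (auto simp: not_less)
    then show "0 \<le> s * ?L + s\<^sup>2 * (\<beta> / 2 * (\<Sum>t<N. \<Sum>i<m. \<Sum>j<mt t. (dz t j)\<^sup>2))"
      using AL_smooth_expand[of N m mt a D \<beta> u s "\<lambda>_. 0" V "\<lambda>_ _ _. 0" y "\<lambda>_ _. 0" z dz lam Lam]
      by simp
  qed
  also have "(\<Sum>t<N. \<Sum>i<m. \<Sum>j<mt t. ?M t i j * - dz t j) = (\<Sum>t<N. \<Sum>j<mt t. - dz t j * (\<Sum>i<m. ?M t i j))"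
  proof (rule sum.cong[OF refl])
    fix t
    have "(\<Sum>i<m. \<Sum>j<mt t. ?M t i j * - dz t j) = (\<Sum>j<mt t. \<Sum>i<m. ?M t i j * - dz t j)"
      by (rule sum.swap)
    then show "(\<Sum>i<m. \<Sum>j<mt t. ?M t i j * - dz t j) = (\<Sum>j<mt t. - dz t j * (\<Sum>i<m. ?M t i j))"
      by (simp only: sum_distrib_left mult.commute)
  qed
  also have "(\<Sum>t<N. \<Sum>j<mt t. dz t j * a t j) + \<dots> = (\<Sum>t<N. \<Sum>j<mt t. - (c t j)\<^sup>2)"
    unfolding sum.distrib[symmetric]
    by (intro sum.cong) (auto simp: dz_def c_def power2_eq_square algebra_simps)
  finally have "(\<Sum>t<N. \<Sum>j<mt t. (c t j)\<^sup>2) \<le> 0" by (simp add: sum_negf)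
  then have "(c t j)\<^sup>2 = 0"
    using assms(3,4) by (intro sum_blocks_nonneg_le_0_imp_0[where N = N and n = mt and f = "\<lambda>t j. (c t j)\<^sup>2"]) auto
  then show ?thesis by (simp add: c_def)
qed

lemma arg_min_y_stationary:
  assumes "is_arg_min (\<lambda>y'. AL N m mt a D \<beta> u V y' z lam Lam) (\<lambda>y'. y' \<in> famVec N m) y"
    and V: "\<forall>t<N. \<forall>i<m. \<forall>j<mt t. 0 \<le> V t i j" and "t < N" "i < m"
  shows "lam i + \<beta> * ((\<Sum>t<N. y t i) - u i) = (\<Sum>j<mt t. Lam t i j + \<beta> * resid D V y z t i j)"
proof -
  let ?M = "\<lambda>t i j. Lam t i j + \<beta> * resid D V y z t i j"
  let ?\<nu> = "\<lambda>i. lam i + \<beta> * ((\<Sum>t<N. y t i) - u i)"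
  define c where "c t i = ?\<nu> i - (\<Sum>j<mt t. ?M t i j)" for t i
  define dy where "dy t i = (if t < N \<and> i < m then - c t i else 0)" for t i
  have y: "y \<in> famVec N m" using assms(1) by (simp add: is_arg_min_def)
  have "0 \<le> (\<Sum>i<m. ?\<nu> i * (\<Sum>t<N. dy t i))
      + (\<Sum>t<N. \<Sum>i<m. \<Sum>j<mt t. ?M t i j * - dy t i)" (is "0 \<le> ?L")
  proof (rule nonneg_linear_coeff)
    fix s :: real
    have "(\<lambda>t i. y t i + s * dy t i) \<in> famVec N m" using y by (auto simp: famVec_def dy_def)
    then have "AL_smooth N m mt a D \<beta> u V y z lam Lam
        \<le> AL_smooth N m mt a D \<beta> u V (\<lambda>t i. y t i + s * dy t i) z lam Lam"
      using assms(1) V unfolding is_arg_min_def AL_eq by (auto simp: not_less)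
    then show "0 \<le> s * ?L + s\<^sup>2 * (\<beta> / 2 * (\<Sum>i<m. (\<Sum>t<N. dy t i)\<^sup>2)
        + \<beta> / 2 * (\<Sum>t<N. \<Sum>i<m. \<Sum>j<mt t. (dy t i)\<^sup>2))"
      using AL_smooth_expand[of N m mt a D \<beta> u s "\<lambda>_. 0" V "\<lambda>_ _ _. 0" y dy z "\<lambda>_ _. 0" lam Lam]
      by simp
  qed
  also have "(\<Sum>i<m. ?\<nu> i * (\<Sum>t<N. dy t i)) = (\<Sum>t<N. \<Sum>i<m. ?\<nu> i * dy t i)"
    unfolding sum_distrib_left by (rule sum.swap)
  also have "\<dots> + (\<Sum>t<N. \<Sum>i<m. \<Sum>j<mt t. ?M t i j * - dy t i)
      = (\<Sum>t<N. \<Sum>i<m. ?\<nu> i * dy t i + (\<Sum>j<mt t. ?M t i j) * - dy t i)"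
    unfolding sum_distrib_right sum.distrib[symmetric] ..
  also have "\<dots> = (\<Sum>t<N. \<Sum>i<m. - (c t i)\<^sup>2)"
    by (intro sum.cong) (auto simp: dy_def c_def power2_eq_square algebra_simps)
  finally have "(\<Sum>t<N. \<Sum>i<m. (c t i)\<^sup>2) \<le> 0" by (simp add: sum_negf)
  then have "(c t i)\<^sup>2 = 0"
    using assms(3,4) by (intro sum_blocks_nonneg_le_0_imp_0[where N = N and n = "\<lambda>_. m" and f = "\<lambda>t i. (c t i)\<^sup>2"]) auto
  then show ?thesis by (simp add: c_def)
qed

text \<open>The zero pair has a finite value, so the minimal value is not infinite.\<close>

lemma arg_min_uV_nonneg:
  assumes "is_arg_min (\<lambda>(u', V'). AL N m mt a D \<beta> u' V' y z lam Lam)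
      (\<lambda>p. p \<in> vecs m \<times> famMat N m mt) (u, V)"
  shows "\<forall>t<N. \<forall>i<m. \<forall>j<mt t. 0 \<le> V t i j"
proof (rule ccontr)
  assume "\<not> ?thesis"
  then have "AL N m mt a D \<beta> u V y z lam Lam = \<infinity>" by (simp add: AL_eq)
  moreover have "((\<lambda>_. 0), (\<lambda>_ _ _. 0)) \<in> vecs m \<times> famMat N m mt"
    by (simp add: vecs_def famMat_def)
  moreover have "AL N m mt a D \<beta> (\<lambda>_. 0) (\<lambda>_ _ _. 0) y z lam Lam < \<infinity>" by (simp add: AL_eq)
  ultimately show False using assms unfolding is_arg_min_def by fastforce
qed

text \<open>Move along the segment towards \<open>(u', V')\<close>. Convexity bounds the change of
  the maximum linearly in \<open>s\<close>, so the first-order argument works without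
  differentiating it.\<close>

lemma arg_min_uV_variational:
  assumes "is_arg_min (\<lambda>(u', V'). AL N m mt a D \<beta> u' V' y z lam Lam)
      (\<lambda>p. p \<in> vecs m \<times> famMat N m mt) (u, V)"
    and u': "u' \<in> vecs m" and V': "V' \<in> famMat N m mt" "\<forall>t<N. \<forall>i<m. \<forall>j<mt t. 0 \<le> V' t i j"
  shows "0 \<le> Max (u' ` {..<m}) - Max (u ` {..<m})
      - (\<Sum>i<m. (lam i + \<beta> * ((\<Sum>t<N. y t i) - u i)) * (u' i - u i))
      + (\<Sum>t<N. \<Sum>i<m. \<Sum>j<mt t. (Lam t i j + \<beta> * resid D V y z t i j) * (V' t i j - V t i j))"
proof -
  have V: "\<forall>t<N. \<forall>i<m. \<forall>j<mt t. 0 \<le> V t i j" by (rule arg_min_uV_nonneg[OF assms(1)])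
  have uV: "u \<in> vecs m" "V \<in> famMat N m mt" using assms(1) by (auto simp: is_arg_min_def)
  let ?L = "(\<Sum>i<m. (lam i + \<beta> * ((\<Sum>t<N. y t i) - u i)) * (u i - u' i))
      + (\<Sum>t<N. \<Sum>i<m. \<Sum>j<mt t. (Lam t i j + \<beta> * resid D V y z t i j) * (V' t i j - V t i j))"
  have "0 \<le> Max (u' ` {..<m}) - Max (u ` {..<m}) + ?L"
  proof (rule nonneg_linear_coeff)
    fix s :: real assume s: "0 < s" "s \<le> 1"
    let ?us = "\<lambda>i. u i + s * (u' i - u i)" and ?Vs = "\<lambda>t i j. V t i j + s * (V' t i j - V t i j)"
    have dom: "?us \<in> vecs m" "?Vs \<in> famMat N m mt"
      using uV u' V' by (auto simp: vecs_def famMat_def)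
    have nonneg: "\<forall>t<N. \<forall>i<m. \<forall>j<mt t. 0 \<le> ?Vs t i j"
    proof (intro allI impI)
      fix t i j assume "t < N" "i < m" "j < mt t"
      then have "0 \<le> (1 - s) * V t i j + s * V' t i j" using s V V' by simp
      then show "0 \<le> ?Vs t i j" by (simp add: algebra_simps)
    qed
    have Max: "Max (?us ` {..<m}) \<le> Max (u ` {..<m}) + s * (Max (u' ` {..<m}) - Max (u ` {..<m}))"
      unfolding Max_le_iff'
    proof (intro allI impI)
      fix i assume "i < m"
      then have "(1 - s) * u i + s * u' i \<le> (1 - s) * Max (u ` {..<m}) + s * Max (u' ` {..<m})"
        using s by (intro add_mono mult_left_mono le_Max) auto
      then show "?us i \<le> Max (u ` {..<m}) + s * (Max (u' ` {..<m}) - Max (u ` {..<m}))"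
        by (simp add: algebra_simps)
    qed
    have "\<not> AL N m mt a D \<beta> ?us ?Vs y z lam Lam < AL N m mt a D \<beta> u V y z lam Lam"
      using assms(1) dom unfolding is_arg_min_def by auto
    then have "Max (u ` {..<m}) + AL_smooth N m mt a D \<beta> u V y z lam Lam
        \<le> Max (?us ` {..<m}) + AL_smooth N m mt a D \<beta> ?us ?Vs y z lam Lam"
      using V nonneg unfolding AL_eq by (simp add: not_less)
    also have "AL_smooth N m mt a D \<beta> ?us ?Vs y z lam Lam
        = AL_smooth N m mt a D \<beta> u V y z lam Lam + s * ?L
          + s\<^sup>2 * (\<beta> / 2 * (\<Sum>i<m. (u i - u' i)\<^sup>2)
            + \<beta> / 2 * (\<Sum>t<N. \<Sum>i<m. \<Sum>j<mt t. (V' t i j - V t i j)\<^sup>2))"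
      using AL_smooth_expand[of N m mt a D \<beta> u s "\<lambda>i. u' i - u i" V "\<lambda>t i j. V' t i j - V t i j"
          y "\<lambda>_ _. 0" z "\<lambda>_ _. 0" lam Lam]
      by simp
    finally show "0 \<le> s * (Max (u' ` {..<m}) - Max (u ` {..<m}) + ?L)
        + s\<^sup>2 * (\<beta> / 2 * (\<Sum>i<m. (u i - u' i)\<^sup>2)
            + \<beta> / 2 * (\<Sum>t<N. \<Sum>i<m. \<Sum>j<mt t. (V' t i j - V t i j)\<^sup>2))"
      using Max unfolding distrib_left[of s] by linarith
  qed
  moreover have "(\<Sum>i<m. (lam i + \<beta> * ((\<Sum>t<N. y t i) - u i)) * (u i - u' i))
      = - (\<Sum>i<m. (lam i + \<beta> * ((\<Sum>t<N. y t i) - u i)) * (u' i - u i))"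
    unfolding sum_negf[symmetric] by (intro sum.cong) (auto simp: algebra_simps)
  ultimately show ?thesis by simp
qed

lemma arg_min_u_subgradient:
  assumes "is_arg_min (\<lambda>(u', V'). AL N m mt a D \<beta> u' V' y z lam Lam)
      (\<lambda>p. p \<in> vecs m \<times> famMat N m mt) (u, V)" and "u' \<in> vecs m"
  shows "(\<Sum>i<m. (lam i + \<beta> * ((\<Sum>t<N. y t i) - u i)) * (u' i - u i))
      \<le> Max (u' ` {..<m}) - Max (u ` {..<m})"
  using arg_min_uV_variational[OF assms _ arg_min_uV_nonneg[OF assms(1)]] assms(1)
  by (simp add: is_arg_min_def)

lemma arg_min_V_complementarity:
  assumes min: "is_arg_min (\<lambda>(u', V'). AL N m mt a D \<beta> u' V' y z lam Lam)
      (\<lambda>p. p \<in> vecs m \<times> famMat N m mt) (u, V)" and tij: "t < N" "i < m" "j < mt t"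
  shows "0 \<le> Lam t i j + \<beta> * resid D V y z t i j"
    and "(Lam t i j + \<beta> * resid D V y z t i j) * V t i j = 0"
proof -
  define M where "M t i j = Lam t i j + \<beta> * resid D V y z t i j" for t i j
  have V: "\<forall>t<N. \<forall>i<m. \<forall>j<mt t. 0 \<le> V t i j" by (rule arg_min_uV_nonneg[OF min])
  have uV: "u \<in> vecs m" "V \<in> famMat N m mt" using min by (auto simp: is_arg_min_def)
  have vi: "0 \<le> (\<Sum>t<N. \<Sum>i<m. \<Sum>j<mt t. M t i j * (V' t i j - V t i j))"
    if "V' \<in> famMat N m mt" "\<forall>t<N. \<forall>i<m. \<forall>j<mt t. 0 \<le> V' t i j" for V'
    using arg_min_uV_variational[OF min uV(1) that] by (simp add: M_def)
  \<comment> \<open>Raising \<open>V\<close> by the negative part of the gradient is admissible and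
    would lower the objective unless that part vanishes.\<close>
  define V' where "V' t i j = (if t < N \<and> i < m \<and> j < mt t then V t i j + max 0 (- M t i j) else 0)" for t i j
  have "0 \<le> (\<Sum>t<N. \<Sum>i<m. \<Sum>j<mt t. M t i j * (V' t i j - V t i j))"
    using V by (intro vi) (auto simp: V'_def famMat_def)
  also have "\<dots> = - (\<Sum>t<N. \<Sum>i<m. \<Sum>j<mt t. (max 0 (- M t i j))\<^sup>2)"
    unfolding sum_negf[symmetric]
    by (intro sum.cong) (auto simp: V'_def max_def power2_eq_square)
  finally have le: "(\<Sum>t<N. \<Sum>i<m. \<Sum>j<mt t. (max 0 (- M t i j))\<^sup>2) \<le> 0" by simp
  have M: "0 \<le> M t i j" if "t < N" "i < m" "j < mt t" for t i j
    using sum_blocks3_nonneg_le_0_imp_0[OF _ le that] by (auto simp: max_def split: if_splits)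
  \<comment> \<open>Comparison with the zero matrix bounds the sum of the nonnegative products by
    0.\<close>
  have "0 \<le> (\<Sum>t<N. \<Sum>i<m. \<Sum>j<mt t. M t i j * (0 - V t i j))"
    using vi[of "\<lambda>_ _ _. 0"] by (simp add: famMat_def)
  then have le: "(\<Sum>t<N. \<Sum>i<m. \<Sum>j<mt t. M t i j * V t i j) \<le> 0" by (simp add: sum_negf)
  have "M t i j * V t i j = 0"
    using M V by (intro sum_blocks3_nonneg_le_0_imp_0[OF _ le tij]) auto
  then show "(Lam t i j + \<beta> * resid D V y z t i j) * V t i j = 0" by (simp add: M_def)
  show "0 \<le> Lam t i j + \<beta> * resid D V y z t i j" using M[OF tij] by (simp add: M_def)
qed

text \<open>Pairing with the constraint map means applying its adjoint to the multipliers. The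
  \<open>z\<close> component of the adjoint vanishes, and its \<open>y\<close> component in block
  \<open>t\<close> is constant in \<open>i\<close>, so only the entry sums of \<open>y t\<close>
  remain. Both equality premises of \<open>admm_descent\<close> come from this.\<close>

lemma constraint_pairing:
  fixes \<nu> c :: "nat \<Rightarrow> real" and M :: "nat \<Rightarrow> nat \<Rightarrow> nat \<Rightarrow> real"
  assumes "\<And>t j. t < N \<Longrightarrow> j < mt t \<Longrightarrow> (\<Sum>i<m. M t i j) = 0"
    and "\<And>t i. t < N \<Longrightarrow> i < m \<Longrightarrow> \<nu> i = (\<Sum>j<mt t. M t i j) - c t"
  shows "(\<Sum>i<m. (\<Sum>t<N. y t i) * \<nu> i) + (\<Sum>t<N. \<Sum>i<m. \<Sum>j<mt t. - (y t i + z t j) * M t i j)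
      = - (\<Sum>t<N. c t * (\<Sum>i<m. y t i))"
proof -
  have "(\<Sum>i<m. (\<Sum>t<N. y t i) * \<nu> i) = (\<Sum>t<N. \<Sum>i<m. y t i * \<nu> i)"
    unfolding sum_distrib_right by (rule sum.swap)
  also have "\<dots> = (\<Sum>t<N. \<Sum>i<m. (\<Sum>j<mt t. y t i * M t i j) - c t * y t i)"
  proof (intro sum.cong refl)
    fix t i assume "t \<in> {..<N}" "i \<in> {..<m}"
    then have "\<nu> i = (\<Sum>j<mt t. M t i j) - c t" by (simp add: assms(2))
    then show "y t i * \<nu> i = (\<Sum>j<mt t. y t i * M t i j) - c t * y t i"
      by (simp add: right_diff_distrib sum_distrib_left)
  qed
  also have "\<dots> = (\<Sum>t<N. \<Sum>i<m. \<Sum>j<mt t. y t i * M t i j) - (\<Sum>t<N. c t * (\<Sum>i<m. y t i))"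
    by (simp add: sum_subtractf sum_distrib_left)
  finally have 1: "(\<Sum>i<m. (\<Sum>t<N. y t i) * \<nu> i)
      = (\<Sum>t<N. \<Sum>i<m. \<Sum>j<mt t. y t i * M t i j) - (\<Sum>t<N. c t * (\<Sum>i<m. y t i))" .
  have "(\<Sum>i<m. \<Sum>j<mt t. z t j * M t i j) = 0" if "t < N" for t
  proof -
    have "(\<Sum>i<m. \<Sum>j<mt t. z t j * M t i j) = (\<Sum>j<mt t. \<Sum>i<m. z t j * M t i j)"
      by (rule sum.swap)
    also have "\<dots> = 0"
      using that assms(1) by (intro sum.neutral) (simp flip: sum_distrib_left)
    finally show ?thesis .
  qed
  then have 2: "(\<Sum>t<N. \<Sum>i<m. \<Sum>j<mt t. z t j * M t i j) = 0" by simp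
  have "(\<Sum>t<N. \<Sum>i<m. \<Sum>j<mt t. - (y t i + z t j) * M t i j)
      = - (\<Sum>t<N. \<Sum>i<m. \<Sum>j<mt t. y t i * M t i j) - (\<Sum>t<N. \<Sum>i<m. \<Sum>j<mt t. z t j * M t i j)"
    by (simp add: algebra_simps sum.distrib sum_negf sum_subtractf)
  with 1 2 show ?thesis by simp
qed

end

section \<open>Convergence of the iteration\<close>

locale barycenter_admm = barycenter N m mt D a
  for N m :: nat and mt :: "nat \<Rightarrow> nat" and D :: "nat \<Rightarrow> nat \<Rightarrow> nat \<Rightarrow> real"
    and a :: "nat \<Rightarrow> nat \<Rightarrow> real" +
  fixes \<beta> \<tau> :: real
    and u lam :: "nat \<Rightarrow> nat \<Rightarrow> real"
    and y z zt :: "nat \<Rightarrow> nat \<Rightarrow> nat \<Rightarrow> real"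
    and V Lam :: "nat \<Rightarrow> nat \<Rightarrow> nat \<Rightarrow> nat \<Rightarrow> real"
  assumes beta: "0 < \<beta>" and tau: "0 < \<tau>" "\<tau> < (1 + sqrt 5) / 2"
    and lam0: "lam 0 \<in> vecs m"
    and step1: "is_arg_min (\<lambda>(u', V'). AL N m mt a D \<beta> u' V' (y k) (z k) (lam k) (Lam k))
                   (\<lambda>p. p \<in> vecs m \<times> famMat N m mt) (u (Suc k), V (Suc k))"
    and step2a: "is_arg_min (\<lambda>z'. AL N m mt a D \<beta> (u (Suc k)) (V (Suc k)) (y k) z' (lam k) (Lam k))
                   (\<lambda>z'. z' \<in> famVecT N mt) (zt (Suc k))"
    and step2b: "is_arg_min (\<lambda>y'. AL N m mt a D \<beta> (u (Suc k)) (V (Suc k)) y' (zt (Suc k)) (lam k) (Lam k))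
                   (\<lambda>y'. y' \<in> famVec N m) (y (Suc k))"
    and step2c: "is_arg_min (\<lambda>z'. AL N m mt a D \<beta> (u (Suc k)) (V (Suc k)) (y (Suc k)) z' (lam k) (Lam k))
                   (\<lambda>z'. z' \<in> famVecT N mt) (z (Suc k))"
    and step3a: "lam (Suc k) = (\<lambda>i. lam k i + \<tau> * \<beta> * ((\<Sum>t<N. y (Suc k) t i) - u (Suc k) i))"
    and step3b: "Lam (Suc k) = (\<lambda>t i j. if t < N \<and> i < m \<and> j < mt t
                   then Lam k t i j + \<tau> * \<beta> * resid D (V (Suc k)) (y (Suc k)) (z (Suc k)) t i j
                   else 0)"
begin

section \<open>Residuals and stationarity along the iterates\<close>

definition q where "q k i = (\<Sum>t<N. y k t i) - u k i"
definition R where "R k = resid D (V k) (y k) (z k)"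
definition S where "S k t = (\<Sum>i<m. y k t i)"
definition \<omega> where "\<omega> t = \<beta> * mt t / m"

lemma domain:
  "u (Suc k) \<in> vecs m" "V (Suc k) \<in> famMat N m mt" "y (Suc k) \<in> famVec N m" "z (Suc k) \<in> famVecT N mt"
  using step1[of k] step2b[of k] step2c[of k] by (auto simp: is_arg_min_def)

lemma lam_domain: "lam k \<in> vecs m"
proof (induction k)
  case (Suc k)
  then show ?case using domain[of k] by (auto simp: step3a vecs_def famVec_def)
qed (rule lam0)

lemma \<omega>_pos: "t < N \<Longrightarrow> 0 < \<omega> t"
  using beta m mt[of t] by (simp add: \<omega>_def)

lemma lam_Suc: "lam (Suc k) i = lam k i + \<tau> * \<beta> * q (Suc k) i"
  by (simp add: step3a q_def)

lemma Lam_Suc: "t < N \<Longrightarrow> i < m \<Longrightarrow> j < mt t \<Longrightarrow> Lam (Suc k) t i j = Lam k t i j + \<tau> * \<beta> * R (Suc k) t i j"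
  by (simp add: step3b R_def)

lemma V_nonneg: "t < N \<Longrightarrow> i < m \<Longrightarrow> j < mt t \<Longrightarrow> 0 \<le> V (Suc k) t i j"
  using arg_min_uV_nonneg[OF step1] by blast

text \<open>Because (2c) closes the sweep, this condition holds at the new iterate without a
  proximal term.\<close>

lemma stationary_z:
  assumes "t < N" "j < mt t"
  shows "a t j = (\<Sum>i<m. Lam k t i j + \<beta> * R (Suc k) t i j)"
  using arg_min_z_stationary[OF step2c _ assms] V_nonneg by (simp add: R_def)

text \<open>The two \<open>z\<close>-steps differ by a shift, which turns the Gauss--Seidel sweep into one joint
  \<open>(y, z)\<close>-step with an additional proximal term.\<close>

lemma zt_eq:
  assumes "t < N" "j < mt t"
  shows "zt (Suc k) t j = z (Suc k) t j + (S (Suc k) t - S k t) / m"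
proof -
  let ?f = "\<lambda>i. Lam k t i j + \<beta> * resid D (V (Suc k)) (y k) (zt (Suc k)) t i j"
  let ?g = "\<lambda>i. Lam k t i j + \<beta> * resid D (V (Suc k)) (y (Suc k)) (z (Suc k)) t i j"
  have "a t j = sum ?f {..<m}" "a t j = sum ?g {..<m}"
    using V_nonneg by (intro arg_min_z_stationary[OF step2a _ assms] arg_min_z_stationary[OF step2c _ assms]; blast)+
  then have "0 = (\<Sum>i<m. ?f i - ?g i)" by (simp only: sum_subtractf)
  also have "\<dots> = (\<Sum>i<m. \<beta> * (y (Suc k) t i - y k t i - (zt (Suc k) t j - z (Suc k) t j)))"
    by (intro sum.cong refl) (simp add: resid_def algebra_simps)
  also have "\<dots> = \<beta> * (S (Suc k) t - S k t - m * (zt (Suc k) t j - z (Suc k) t j))"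
    unfolding sum_distrib_left[symmetric] by (simp add: S_def sum_subtractf)
  finally have "S (Suc k) t - S k t = m * (zt (Suc k) t j - z (Suc k) t j)"
    using beta by simp
  then show ?thesis using m by (simp add: field_simps)
qed

text \<open>The \<open>y\<close>-step uses \<open>zt\<close> instead of the final \<open>z\<close>.
  By \<open>zt_eq\<close> this shifts each of the \<open>mt t\<close> residuals in a row by the
  increment of \<open>S t\<close> divided by \<open>m\<close>, and the shifts add up to the \<omega>
  term.\<close>

lemma stationary_y:
  assumes "t < N" "i < m"
  shows "lam k i + \<beta> * q (Suc k) i
    = (\<Sum>j<mt t. Lam k t i j + \<beta> * R (Suc k) t i j) - \<omega> t * (S (Suc k) t - S k t)"
proof -
  have "lam k i + \<beta> * q (Suc k) i
      = (\<Sum>j<mt t. Lam k t i j + \<beta> * resid D (V (Suc k)) (y (Suc k)) (zt (Suc k)) t i j)"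
    using arg_min_y_stationary[OF step2b _ assms] V_nonneg by (simp add: q_def)
  also have "\<dots> = (\<Sum>j<mt t. (Lam k t i j + \<beta> * R (Suc k) t i j) - \<beta> * (S (Suc k) t - S k t) / m)"
    using assms by (intro sum.cong) (auto simp: R_def resid_def zt_eq algebra_simps)
  also have "\<dots> = (\<Sum>j<mt t. Lam k t i j + \<beta> * R (Suc k) t i j) - \<omega> t * (S (Suc k) t - S k t)"
    by (simp add: sum_subtractf \<omega>_def)
  finally show ?thesis .
qed

text \<open>Both constraints of (D) are stacked into one family indexed by \<open>E\<close>, so that they read
  \<open>Xv u V + Yv y z = 0\<close>, and \<open>Mv\<close> stacks the multipliers accordingly.\<close>

definition E :: "(nat + nat \<times> nat \<times> nat) set" where "E = {..<m} <+> cells"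
definition Yv :: "(nat \<Rightarrow> nat \<Rightarrow> real) \<Rightarrow> (nat \<Rightarrow> nat \<Rightarrow> real) \<Rightarrow> nat + nat \<times> nat \<times> nat \<Rightarrow> real" where
  "Yv y' z' = case_sum (\<lambda>i. \<Sum>t<N. y' t i) (\<lambda>(t, i, j). - (y' t i + z' t j))"
definition Xv :: "(nat \<Rightarrow> real) \<Rightarrow> (nat \<Rightarrow> nat \<Rightarrow> nat \<Rightarrow> real) \<Rightarrow> nat + nat \<times> nat \<times> nat \<Rightarrow> real" where
  "Xv u' V' = case_sum (\<lambda>i. - u' i) (\<lambda>(t, i, j). V' t i j - D t i j)"
definition Mv :: "(nat \<Rightarrow> real) \<Rightarrow> (nat \<Rightarrow> nat \<Rightarrow> nat \<Rightarrow> real) \<Rightarrow> nat + nat \<times> nat \<times> nat \<Rightarrow> real" where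
  "Mv w P = case_sum w (\<lambda>(t, i, j). P t i j)"
definition r where "r k e = Xv (u k) (V k) e + Yv (y k) (z k) e"

lemma finite_E [simp]: "finite E"
  by (simp add: E_def)

lemma mem_E [simp]: "Inl i \<in> E \<longleftrightarrow> i < m" "Inr (t, i, j) \<in> E \<longleftrightarrow> t < N \<and> i < m \<and> j < mt t"
  by (auto simp: E_def)

lemma E_cases [consumes 1, case_names Inl Inr]:
  assumes "e \<in> E"
  obtains i where "e = Inl i" "i < m" | t i j where "e = Inr (t, i, j)" "t < N" "i < m" "j < mt t"
  using assms by (cases e) (auto simp: E_def cells_def)

lemma sum_E: "sum f E = (\<Sum>i<m. f (Inl i)) + (\<Sum>t<N. \<Sum>i<m. \<Sum>j<mt t. f (Inr (t, i, j)))"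
  unfolding E_def by (rule sum_constraints)

lemma vec_simps [simp]:
  "Yv y' z' (Inl i) = (\<Sum>t<N. y' t i)" "Yv y' z' (Inr (t, i, j)) = - (y' t i + z' t j)"
  "Xv u' V' (Inl i) = - u' i" "Xv u' V' (Inr (t, i, j)) = V' t i j - D t i j"
  "Mv w P (Inl i) = w i" "Mv w P (Inr (t, i, j)) = P t i j"
  by (simp_all add: Yv_def Xv_def Mv_def)

lemma r_simps [simp]: "r k (Inl i) = q k i" "r k (Inr (t, i, j)) = R k t i j"
  by (simp_all add: r_def q_def R_def resid_def)

lemma Mv_Suc:
  "e \<in> E \<Longrightarrow> Mv (lam (Suc k)) (Lam (Suc k)) e = Mv (lam k) (Lam k) e + \<tau> * \<beta> * r (Suc k) e"
  by (erule E_cases) (simp_all add: lam_Suc Lam_Suc)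

text \<open>Subtracting the increment of \<open>Yv\<close> from \<open>r (Suc k)\<close> gives the
  residual at the old \<open>y\<close> and \<open>z\<close>, which is the one seen in step (1). The
  bracket is therefore a difference of two multipliers that satisfy the optimality conditions of the
  first block, at the iterate and at the KKT point.\<close>

lemma first_block_monotone:
  assumes "KKT us Vs ys zs ws Ps"
  shows "(\<Sum>e\<in>E. (Xv (u (Suc k)) (V (Suc k)) e - Xv us Vs e)
      * (Mv (lam k) (Lam k) e - Mv ws Ps e + \<beta> * r (Suc k) e
        - \<beta> * (Yv (y (Suc k)) (z (Suc k)) e - Yv (y k) (z k) e))) \<le> 0"
proof -
  define \<nu> where "\<nu> i = lam k i + \<beta> * ((\<Sum>t<N. y k t i) - u (Suc k) i)" for i
  define M where "M t i j = Lam k t i j + \<beta> * resid D (V (Suc k)) (y k) (z k) t i j" for t i j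
  have D: "D_feas N m mt D us Vs ys zs" and P: "P_feas N m mt a ws Ps"
    and cs: "\<And>t i j. t < N \<Longrightarrow> i < m \<Longrightarrow> j < mt t \<Longrightarrow> 0 \<le> Vs t i j \<and> 0 \<le> Ps t i j \<and> Vs t i j * Ps t i j = 0"
    and us: "Max (us ` {..<m}) \<le> (\<Sum>i<m. ws i * us i)"
    using assms unfolding KKT_def Max_le_iff' by blast+
  have ws: "ws \<in> prob_simplex m" using P_feas_prob_simplex[OF P] cs by blast
  have "(\<Sum>i<m. ws i * u (Suc k) i) \<le> (\<Sum>i<m. ws i * Max (u (Suc k) ` {..<m}))"
    using ws by (intro sum_mono mult_left_mono) (auto simp: prob_simplex_def)
  also have "\<dots> = Max (u (Suc k) ` {..<m})"
    using ws by (simp add: prob_simplex_def flip: sum_distrib_right)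
  finally have "(\<Sum>i<m. ws i * u (Suc k) i) \<le> Max (u (Suc k) ` {..<m})" .
  moreover have "(\<Sum>i<m. \<nu> i * (us i - u (Suc k) i)) \<le> Max (us ` {..<m}) - Max (u (Suc k) ` {..<m})"
    unfolding \<nu>_def using D by (intro arg_min_u_subgradient[OF step1]) (simp add: D_feas_def)
  ultimately have "(\<Sum>i<m. \<nu> i * (us i - u (Suc k) i)) \<le> (\<Sum>i<m. ws i * us i) - (\<Sum>i<m. ws i * u (Suc k) i)"
    using us by linarith
  then have 1: "(\<Sum>i<m. (us i - u (Suc k) i) * (\<nu> i - ws i)) \<le> 0"
    by (simp add: sum_subtractf sum.distrib algebra_simps)
  have 2: "(V (Suc k) t i j - Vs t i j) * (M t i j - Ps t i j) \<le> 0"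
    if "t < N" "i < m" "j < mt t" for t i j
  proof -
    have "0 \<le> M t i j"
      unfolding M_def by (rule arg_min_V_complementarity(1)[OF step1 that])
    then have "0 \<le> M t i j * Vs t i j" "0 \<le> V (Suc k) t i j * Ps t i j"
      using cs[OF that] V_nonneg[OF that] by auto
    moreover have "M t i j * V (Suc k) t i j = 0"
      unfolding M_def by (rule arg_min_V_complementarity(2)[OF step1 that])
    moreover have "Vs t i j * Ps t i j = 0" using cs[OF that] by blast
    moreover have "(V (Suc k) t i j - Vs t i j) * (M t i j - Ps t i j)
        = M t i j * V (Suc k) t i j - M t i j * Vs t i j - V (Suc k) t i j * Ps t i j + Vs t i j * Ps t i j"
      by (simp add: algebra_simps)
    ultimately show ?thesis by linarith
  qed
  have "(\<Sum>e\<in>E. (Xv (u (Suc k)) (V (Suc k)) e - Xv us Vs e)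
      * (Mv (lam k) (Lam k) e - Mv ws Ps e + \<beta> * r (Suc k) e
        - \<beta> * (Yv (y (Suc k)) (z (Suc k)) e - Yv (y k) (z k) e)))
    = (\<Sum>i<m. (us i - u (Suc k) i) * (\<nu> i - ws i))
      + (\<Sum>t<N. \<Sum>i<m. \<Sum>j<mt t. (V (Suc k) t i j - Vs t i j) * (M t i j - Ps t i j))"
    unfolding sum_E
    by (intro arg_cong2[where f = "(+)"] sum.cong refl)
      (simp_all add: \<nu>_def M_def q_def R_def resid_def algebra_simps)
  also have "\<dots> \<le> 0 + 0"
    using 2 by (intro add_mono 1 sum_nonpos) auto
  finally show ?thesis by simp
qed

text \<open>Premise \<open>c\<close> of \<open>admm_descent\<close> compares the second-block
  conditions of two consecutive steps. They hold only after a completed sweep, so the comparison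
  starts at \<open>Suc k\<close>.\<close>

lemma descent:
  assumes KKT: "KKT us Vs ys zs ws Ps"
    and w: "0 \<le> \<kappa>" "\<epsilon> \<le> 1" "\<kappa> + \<epsilon> \<le> 2 - \<tau>" "(1 - \<tau>)\<^sup>2 \<le> \<kappa> * (1 - \<epsilon>)"
  shows "(\<Sum>e\<in>E. (Mv (lam (Suc (Suc k))) (Lam (Suc (Suc k))) e - Mv ws Ps e)\<^sup>2 / (\<tau> * \<beta>)
          + \<beta> * (Yv (y (Suc (Suc k))) (z (Suc (Suc k))) e - Yv ys zs e)\<^sup>2)
        + (\<Sum>t<N. \<omega> t * (S (Suc (Suc k)) t - (\<Sum>i<m. ys t i))\<^sup>2)
      + ((\<Sum>e\<in>E. \<kappa> * \<beta> * (r (Suc (Suc k)) e)\<^sup>2) + (\<Sum>t<N. \<omega> t * (S (Suc (Suc k)) t - S (Suc k) t)\<^sup>2))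
      + ((\<Sum>e\<in>E. \<epsilon> * \<beta> * ((r (Suc (Suc k)) e)\<^sup>2
            + (Yv (y (Suc (Suc k))) (z (Suc (Suc k))) e - Yv (y (Suc k)) (z (Suc k)) e)\<^sup>2))
        + (\<Sum>t<N. \<omega> t * (S (Suc (Suc k)) t - S (Suc k) t)\<^sup>2))
    \<le> (\<Sum>e\<in>E. (Mv (lam (Suc k)) (Lam (Suc k)) e - Mv ws Ps e)\<^sup>2 / (\<tau> * \<beta>)
          + \<beta> * (Yv (y (Suc k)) (z (Suc k)) e - Yv ys zs e)\<^sup>2)
        + (\<Sum>t<N. \<omega> t * (S (Suc k) t - (\<Sum>i<m. ys t i))\<^sup>2)
      + ((\<Sum>e\<in>E. \<kappa> * \<beta> * (r (Suc k) e)\<^sup>2) + (\<Sum>t<N. \<omega> t * (S (Suc k) t - S k t)\<^sup>2))"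
proof -
  let ?k1 = "Suc k" and ?k2 = "Suc (Suc k)"
  have D: "D_feas N m mt D us Vs ys zs" and P: "P_feas N m mt a ws Ps"
    using KKT unfolding KKT_def by blast+
  define \<mu> where "\<mu> e = Mv (lam ?k1) (Lam ?k1) e - Mv ws Ps e" for e
  define X where "X e = Xv (u ?k2) (V ?k2) e - Xv us Vs e" for e
  define Y where "Y e = Yv (y ?k2) (z ?k2) e - Yv ys zs e" for e
  define b where "b e = Yv (y ?k2) (z ?k2) e - Yv (y ?k1) (z ?k1) e" for e
  define Se where "Se t = S ?k2 t - (\<Sum>i<m. ys t i)" for t
  define d where "d t = S ?k2 t - S ?k1 t" for t
  define d' where "d' t = S ?k1 t - S k t" for t
  have XY: "r ?k2 e = X e + Y e" if "e \<in> E" for e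
  proof -
    have "Xv us Vs e + Yv ys zs e = 0"
      using that
    proof (cases rule: E_cases)
      case (Inl i)
      then show ?thesis using D by (simp add: D_feas_def)
    next
      case (Inr t i j)
      then have "resid D Vs ys zs t i j = 0" using D by (simp add: D_feas_def)
      with Inr show ?thesis by (simp add: resid_def)
    qed
    then show ?thesis by (simp add: r_def X_def Y_def)
  qed
  have a: "(\<Sum>e\<in>E. X e * (\<mu> e + \<beta> * r ?k2 e - \<beta> * b e)) \<le> 0"
    using first_block_monotone[OF KKT, of ?k1] by (simp add: X_def \<mu>_def b_def)
  \<comment> \<open>The second-block conditions minus the marginal equations of the KKT point; the
    proximal term leaves the constant \<omega> t * d t in each row.\<close>
  have b: "(\<Sum>e\<in>E. Y e * (\<mu> e + \<beta> * r ?k2 e)) + (\<Sum>t<N. \<omega> t * Se t * d t) = 0"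
  proof -
    let ?\<nu> = "\<lambda>i. lam ?k1 i + \<beta> * q ?k2 i - ws i"
    let ?M = "\<lambda>t i j. Lam ?k1 t i j + \<beta> * R ?k2 t i j - Ps t i j"
    have "(\<Sum>i<m. (\<Sum>t<N. y ?k2 t i - ys t i) * ?\<nu> i)
        + (\<Sum>t<N. \<Sum>i<m. \<Sum>j<mt t. - ((y ?k2 t i - ys t i) + (z ?k2 t j - zs t j)) * ?M t i j)
      = - (\<Sum>t<N. \<omega> t * d t * (\<Sum>i<m. y ?k2 t i - ys t i))"
    proof (rule constraint_pairing)
      show "(\<Sum>i<m. ?M t i j) = 0" if "t < N" "j < mt t" for t j
        using stationary_z[OF that, of ?k1] P that unfolding P_feas_def by (simp add: sum_subtractf)
      show "?\<nu> i = (\<Sum>j<mt t. ?M t i j) - \<omega> t * d t" if "t < N" "i < m" for t i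
        using stationary_y[OF that, of ?k1] P that unfolding P_feas_def d_def by (simp add: sum_subtractf)
    qed
    moreover have "(\<Sum>e\<in>E. Y e * (\<mu> e + \<beta> * r ?k2 e)) = (\<Sum>i<m. (\<Sum>t<N. y ?k2 t i - ys t i) * ?\<nu> i)
        + (\<Sum>t<N. \<Sum>i<m. \<Sum>j<mt t. - ((y ?k2 t i - ys t i) + (z ?k2 t j - zs t j)) * ?M t i j)"
      unfolding sum_E
      by (intro arg_cong2[where f = "(+)"] sum.cong refl)
        (simp_all add: Y_def \<mu>_def sum_subtractf algebra_simps)
    ultimately show ?thesis
      by (simp add: Se_def S_def sum_subtractf mult_ac)
  qed
  have c: "(\<Sum>e\<in>E. b e * (\<beta> * r ?k2 e - (1 - \<tau>) * \<beta> * r ?k1 e)) + (\<Sum>t<N. \<omega> t * d t * (d t - d' t)) = 0"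
  proof -
    let ?\<nu> = "\<lambda>i. \<beta> * q ?k2 i - (1 - \<tau>) * \<beta> * q ?k1 i"
    let ?M = "\<lambda>t i j. \<beta> * R ?k2 t i j - (1 - \<tau>) * \<beta> * R ?k1 t i j"
    \<comment> \<open>The multiplier update contributes \<tau> * \<beta> times the previous
      residual, which turns its coefficient -\<beta> into -(1 - \<tau>) * \<beta>.\<close>
    have \<nu>: "?\<nu> i = (lam ?k1 i + \<beta> * q ?k2 i) - (lam k i + \<beta> * q ?k1 i)" for i
      by (simp add: lam_Suc algebra_simps)
    have M: "?M t i j = (Lam ?k1 t i j + \<beta> * R ?k2 t i j) - (Lam k t i j + \<beta> * R ?k1 t i j)"
      if "t < N" "i < m" "j < mt t" for t i j
      using that by (simp add: Lam_Suc algebra_simps)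
    have "(\<Sum>i<m. (\<Sum>t<N. y ?k2 t i - y ?k1 t i) * ?\<nu> i)
        + (\<Sum>t<N. \<Sum>i<m. \<Sum>j<mt t. - ((y ?k2 t i - y ?k1 t i) + (z ?k2 t j - z ?k1 t j)) * ?M t i j)
      = - (\<Sum>t<N. \<omega> t * (d t - d' t) * (\<Sum>i<m. y ?k2 t i - y ?k1 t i))"
    proof (rule constraint_pairing)
      show "(\<Sum>i<m. ?M t i j) = 0" if "t < N" "j < mt t" for t j
      proof -
        have "(\<Sum>i<m. ?M t i j) = (\<Sum>i<m. Lam ?k1 t i j + \<beta> * R ?k2 t i j) - (\<Sum>i<m. Lam k t i j + \<beta> * R ?k1 t i j)"
          unfolding sum_subtractf[symmetric] using that by (intro sum.cong) (auto simp: M)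
        then show ?thesis using stationary_z[OF that, of ?k1] stationary_z[OF that, of k] by simp
      qed
      show "?\<nu> i = (\<Sum>j<mt t. ?M t i j) - \<omega> t * (d t - d' t)" if "t < N" "i < m" for t i
      proof -
        have "(\<Sum>j<mt t. ?M t i j) = (\<Sum>j<mt t. Lam ?k1 t i j + \<beta> * R ?k2 t i j) - (\<Sum>j<mt t. Lam k t i j + \<beta> * R ?k1 t i j)"
          unfolding sum_subtractf[symmetric] using that by (intro sum.cong) (auto simp: M)
        then show ?thesis unfolding \<nu> d_def d'_def
          using stationary_y[OF that, of ?k1] stationary_y[OF that, of k]
          by (simp add: algebra_simps)
      qed
    qed
    moreover have "(\<Sum>e\<in>E. b e * (\<beta> * r ?k2 e - (1 - \<tau>) * \<beta> * r ?k1 e))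
      = (\<Sum>i<m. (\<Sum>t<N. y ?k2 t i - y ?k1 t i) * ?\<nu> i)
        + (\<Sum>t<N. \<Sum>i<m. \<Sum>j<mt t. - ((y ?k2 t i - y ?k1 t i) + (z ?k2 t j - z ?k1 t j)) * ?M t i j)"
      unfolding sum_E
      by (intro arg_cong2[where f = "(+)"] sum.cong refl)
        (simp_all add: b_def sum_subtractf algebra_simps)
    moreover have "(\<Sum>i<m. y ?k2 t i - y ?k1 t i) = d t" for t
      by (simp add: d_def S_def sum_subtractf)
    ultimately show ?thesis by (simp add: mult_ac)
  qed
  have \<mu>': "Mv (lam ?k2) (Lam ?k2) e - Mv ws Ps e = \<mu> e + \<tau> * \<beta> * r ?k2 e" if "e \<in> E" for e
    using Mv_Suc[OF that, of ?k1] by (simp add: \<mu>_def)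
  have Yb: "Yv (y ?k1) (z ?k1) e - Yv ys zs e = Y e - b e" for e
    by (simp add: Y_def b_def)
  have Sd: "S ?k1 t - (\<Sum>i<m. ys t i) = Se t - d t" for t
    by (simp add: Se_def d_def)
  have "(\<Sum>e\<in>E. (Mv (lam ?k2) (Lam ?k2) e - Mv ws Ps e)\<^sup>2 / (\<tau> * \<beta>) + \<beta> * (Yv (y ?k2) (z ?k2) e - Yv ys zs e)\<^sup>2)
      = (\<Sum>e\<in>E. (\<mu> e + \<tau> * \<beta> * r ?k2 e)\<^sup>2 / (\<tau> * \<beta>) + \<beta> * (Y e)\<^sup>2)"
    by (intro sum.cong refl) (simp add: \<mu>' Y_def)
  then show ?thesis
    unfolding Yb Sd d_def[symmetric] d'_def[symmetric] b_def[symmetric] \<mu>_def[symmetric] Se_def[symmetric]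
    using admm_descent[OF beta tau(1) w _ XY a b c] \<omega>_pos by (simp add: less_imp_le)
qed

text \<open>The optimality conditions are passed to the limit along \<sigma>. Convergence of
  \<open>Mv\<close>, \<open>Yv\<close> and \<open>S\<close> suffices because the original variables
  are continuous functions of these and of the residuals.\<close>

lemma KKT_limit:
  assumes \<sigma>: "strict_mono \<sigma>"
    and r0: "\<And>e. e \<in> E \<Longrightarrow> (\<lambda>n. r (Suc n) e) \<longlonglongrightarrow> 0"
    and b0: "\<And>e. e \<in> E \<Longrightarrow> (\<lambda>n. Yv (y (Suc n)) (z (Suc n)) e - Yv (y n) (z n) e) \<longlonglongrightarrow> 0"
    and d0: "\<And>t. t < N \<Longrightarrow> (\<lambda>n. S (Suc n) t - S n t) \<longlonglongrightarrow> 0"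
    and Ml: "\<And>e. e \<in> E \<Longrightarrow> (\<lambda>n. Mv (lam (Suc (\<sigma> n))) (Lam (Suc (\<sigma> n))) e) \<longlonglongrightarrow> Ml e"
    and Yl: "\<And>e. e \<in> E \<Longrightarrow> (\<lambda>n. Yv (y (Suc (\<sigma> n))) (z (Suc (\<sigma> n))) e) \<longlonglongrightarrow> Yl e"
    and Sl: "\<And>t. t < N \<Longrightarrow> (\<lambda>n. S (Suc (\<sigma> n)) t) \<longlonglongrightarrow> Sl t"
  obtains us Vs ys zs ws Ps where "KKT us Vs ys zs ws Ps"
    "\<And>i. (\<lambda>n. u (Suc (\<sigma> n)) i) \<longlonglongrightarrow> us i" "\<And>t i j. (\<lambda>n. V (Suc (\<sigma> n)) t i j) \<longlonglongrightarrow> Vs t i j"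
    "\<And>t i. (\<lambda>n. y (Suc (\<sigma> n)) t i) \<longlonglongrightarrow> ys t i" "\<And>t j. (\<lambda>n. z (Suc (\<sigma> n)) t j) \<longlonglongrightarrow> zs t j"
    "\<And>i. (\<lambda>n. lam (Suc (\<sigma> n)) i) \<longlonglongrightarrow> ws i" "\<And>t i j. (\<lambda>n. Lam (Suc (\<sigma> n)) t i j) \<longlonglongrightarrow> Ps t i j"
    "\<And>e. e \<in> E \<Longrightarrow> Mv ws Ps e = Ml e" "\<And>e. e \<in> E \<Longrightarrow> Yv ys zs e = Yl e"
    "\<And>t. t < N \<Longrightarrow> (\<Sum>i<m. ys t i) = Sl t"
proof -
  \<comment> \<open>Summing the entries -(y t i + z t j) over \<open>i\<close> gives -(S t + m * z t
    j), which is solved for \<open>z\<close>. Column 0, which exists by \<open>mt\<close>, then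
    gives \<open>y\<close>.\<close>
  define zs where "zs t j = (if t < N \<and> j < mt t then - ((\<Sum>i<m. Yl (Inr (t, i, j))) + Sl t) / m else 0)" for t j
  define ys where "ys t i = (if t < N \<and> i < m then - Yl (Inr (t, i, 0)) - zs t 0 else 0)" for t i
  \<comment> \<open>Defined through the constraints, so dual feasibility holds by construction, and
    convergence to these values follows from the vanishing residuals.\<close>
  define us where "us i = (\<Sum>t<N. ys t i)" for i
  define Vs where "Vs t i j = (if t < N \<and> i < m \<and> j < mt t then D t i j + ys t i + zs t j else 0)" for t i j
  define ws where "ws i = (if i < m then Ml (Inl i) else 0)" for i
  define Ps where "Ps t i j = (if t < N \<and> i < m \<and> j < mt t then Ml (Inr (t, i, j)) else 0)" for t i j
  note sub = LIMSEQ_subseq_LIMSEQ[OF _ \<sigma>, unfolded o_def]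
  have z: "(\<lambda>n. z (Suc (\<sigma> n)) t j) \<longlonglongrightarrow> zs t j" for t j
  proof (cases "t < N \<and> j < mt t")
    case True
    have "z k t j = - ((\<Sum>i<m. Yv (y k) (z k) (Inr (t, i, j))) + S k t) / m" for k
      using m by (simp add: S_def sum.distrib sum_negf sum_subtractf field_simps)
    moreover have "(\<lambda>n. - ((\<Sum>i<m. Yv (y (Suc (\<sigma> n))) (z (Suc (\<sigma> n))) (Inr (t, i, j))) + S (Suc (\<sigma> n)) t) / m)
        \<longlonglongrightarrow> - ((\<Sum>i<m. Yl (Inr (t, i, j))) + Sl t) / m"
      using True m by (intro tendsto_intros Yl Sl) auto
    ultimately show ?thesis using True by (simp add: zs_def)
  next
    case False
    then have "z (Suc k) t j = 0" for k using domain(4)[of k] by (auto simp: famVecT_def not_less)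
    then show ?thesis using False by (simp only: zs_def if_False tendsto_const)
  qed
  have y: "(\<lambda>n. y (Suc (\<sigma> n)) t i) \<longlonglongrightarrow> ys t i" for t i
  proof (cases "t < N \<and> i < m")
    case True
    have "y k t i = - Yv (y k) (z k) (Inr (t, i, 0)) - z k t 0" for k by simp
    moreover have "(\<lambda>n. - Yv (y (Suc (\<sigma> n))) (z (Suc (\<sigma> n))) (Inr (t, i, 0)) - z (Suc (\<sigma> n)) t 0)
        \<longlonglongrightarrow> - Yl (Inr (t, i, 0)) - zs t 0"
      using True mt[of t] by (intro tendsto_intros Yl z) auto
    ultimately show ?thesis using True by (simp add: ys_def)
  next
    case False
    then have "y (Suc k) t i = 0" for k using domain(3)[of k] by (auto simp: famVec_def not_less)
    then show ?thesis using False by (simp only: ys_def if_False tendsto_const)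
  qed
  have Y: "Yv ys zs e = Yl e" if "e \<in> E" for e
  proof -
    have "(\<lambda>n. Yv (y (Suc (\<sigma> n))) (z (Suc (\<sigma> n))) e) \<longlonglongrightarrow> Yv ys zs e"
      using that by (cases rule: E_cases) (auto intro!: tendsto_intros y z)
    then show ?thesis using Yl[OF that] by (rule LIMSEQ_unique)
  qed
  have Ssum: "(\<Sum>i<m. ys t i) = Sl t" if "t < N" for t
  proof -
    have "(\<lambda>n. S (Suc (\<sigma> n)) t) \<longlonglongrightarrow> (\<Sum>i<m. ys t i)"
      unfolding S_def by (intro tendsto_intros y)
    then show ?thesis using Sl[OF that] by (rule LIMSEQ_unique)
  qed
  have lam: "(\<lambda>n. lam (Suc (\<sigma> n)) i) \<longlonglongrightarrow> ws i" for i
  proof (cases "i < m")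
    case True
    then show ?thesis using Ml[of "Inl i"] by (simp add: ws_def)
  next
    case False
    then have "lam k i = 0" for k using lam_domain[of k] by (simp add: vecs_def)
    then show ?thesis using False by (simp add: ws_def)
  qed
  have Lam: "(\<lambda>n. Lam (Suc (\<sigma> n)) t i j) \<longlonglongrightarrow> Ps t i j" for t i j
  proof (cases "t < N \<and> i < m \<and> j < mt t")
    case True
    then show ?thesis using Ml[of "Inr (t, i, j)"] by (simp add: Ps_def)
  next
    case False
    then have "Lam (Suc k) t i j = 0" for k by (simp only: step3b if_False)
    then show ?thesis using False by (simp only: Ps_def if_False tendsto_const)
  qed
  have M: "Mv ws Ps e = Ml e" if "e \<in> E" for e
    using that by (cases rule: E_cases) (auto simp: ws_def Ps_def)
  have q0: "(\<lambda>n. q (Suc (\<sigma> n)) i) \<longlonglongrightarrow> 0" if "i < m" for i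
    using sub[OF r0[of "Inl i"]] that by simp
  have R0: "(\<lambda>n. R (Suc (\<sigma> n)) t i j) \<longlonglongrightarrow> 0" if "t < N" "i < m" "j < mt t" for t i j
    using sub[OF r0[of "Inr (t, i, j)"]] that by simp
  have u: "(\<lambda>n. u (Suc (\<sigma> n)) i) \<longlonglongrightarrow> us i" for i
  proof (cases "i < m")
    case True
    have "(\<lambda>n. (\<Sum>t<N. y (Suc (\<sigma> n)) t i) - q (Suc (\<sigma> n)) i) \<longlonglongrightarrow> us i - 0"
      unfolding us_def by (intro tendsto_intros y q0 True)
    then show ?thesis by (simp add: q_def)
  next
    case False
    then have "u (Suc k) i = 0" for k using domain(1)[of k] by (simp add: vecs_def)
    then show ?thesis using False by (simp add: us_def ys_def)
  qed
  have V: "(\<lambda>n. V (Suc (\<sigma> n)) t i j) \<longlonglongrightarrow> Vs t i j" for t i j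
  proof (cases "t < N \<and> i < m \<and> j < mt t")
    case True
    then have "(\<lambda>n. R (Suc (\<sigma> n)) t i j + (D t i j + y (Suc (\<sigma> n)) t i + z (Suc (\<sigma> n)) t j))
        \<longlonglongrightarrow> 0 + (D t i j + ys t i + zs t j)"
      by (intro tendsto_intros y z R0) auto
    then show ?thesis using True by (simp add: R_def resid_def Vs_def)
  next
    case False
    then have "V (Suc k) t i j = 0" for k using domain(2)[of k] by (auto simp: famMat_def not_less)
    then show ?thesis using False by (simp only: Vs_def if_False tendsto_const)
  qed
  \<comment> \<open>The conditions for step \<open>Suc (\<sigma> n)\<close> involve the multipliers
    at \<sigma> n; these have the same limit since their update is a multiple of the
    residual.\<close>
  have lam': "(\<lambda>n. lam (\<sigma> n) i) \<longlonglongrightarrow> ws i" if "i < m" for i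
  proof -
    have "(\<lambda>n. lam (Suc (\<sigma> n)) i - \<tau> * \<beta> * q (Suc (\<sigma> n)) i) \<longlonglongrightarrow> ws i - \<tau> * \<beta> * 0"
      by (intro tendsto_intros lam q0 that)
    then show ?thesis by (simp add: lam_Suc)
  qed
  have Lam': "(\<lambda>n. Lam (\<sigma> n) t i j) \<longlonglongrightarrow> Ps t i j" if "t < N" "i < m" "j < mt t" for t i j
  proof -
    have "(\<lambda>n. Lam (Suc (\<sigma> n)) t i j - \<tau> * \<beta> * R (Suc (\<sigma> n)) t i j) \<longlonglongrightarrow> Ps t i j - \<tau> * \<beta> * 0"
      by (intro tendsto_intros Lam R0 that)
    then show ?thesis by (simp add: Lam_Suc[OF that])
  qed
  have D: "D_feas N m mt D us Vs ys zs"
    by (auto simp: D_feas_def vecs_def famMat_def famVec_def famVecT_def resid_def us_def Vs_def ys_def zs_def)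
  have marg: "(\<Sum>j<mt t. Ps t i j) = ws i" if "t < N" "i < m" for t i
  proof -
    have "(\<lambda>n. lam (\<sigma> n) i + \<beta> * q (Suc (\<sigma> n)) i) \<longlonglongrightarrow> ws i + \<beta> * 0"
      by (intro tendsto_intros lam' q0 that)
    moreover have "(\<lambda>n. (\<Sum>j<mt t. Lam (\<sigma> n) t i j + \<beta> * R (Suc (\<sigma> n)) t i j)
        - \<omega> t * (S (Suc (\<sigma> n)) t - S (\<sigma> n) t)) \<longlonglongrightarrow> (\<Sum>j<mt t. Ps t i j + \<beta> * 0) - \<omega> t * 0"
      using that by (intro tendsto_intros Lam' R0 sub[OF d0]) auto
    ultimately show ?thesis
      using LIMSEQ_unique by (fastforce simp: stationary_y[OF that])
  qed
  have marg': "(\<Sum>i<m. Ps t i j) = a t j" if "t < N" "j < mt t" for t j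
  proof -
    have "(\<lambda>n. \<Sum>i<m. Lam (\<sigma> n) t i j + \<beta> * R (Suc (\<sigma> n)) t i j) \<longlonglongrightarrow> (\<Sum>i<m. Ps t i j + \<beta> * 0)"
      using that by (intro tendsto_intros Lam' R0) auto
    then show ?thesis
      using LIMSEQ_unique[OF _ tendsto_const] by (fastforce simp: stationary_z[OF that, symmetric])
  qed
  have P: "P_feas N m mt a ws Ps"
    using marg marg' by (auto simp: P_feas_def vecs_def famMat_def ws_def Ps_def)
  have grad_V: "(\<lambda>n. Lam (\<sigma> n) t i j + \<beta> * resid D (V (Suc (\<sigma> n))) (y (\<sigma> n)) (z (\<sigma> n)) t i j) \<longlonglongrightarrow> Ps t i j"
    if "t < N" "i < m" "j < mt t" for t i j
  proof -
    have "(\<lambda>n. Lam (\<sigma> n) t i j + \<beta> * (R (Suc (\<sigma> n)) t i j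
        - (Yv (y (Suc (\<sigma> n))) (z (Suc (\<sigma> n))) (Inr (t, i, j)) - Yv (y (\<sigma> n)) (z (\<sigma> n)) (Inr (t, i, j)))))
        \<longlonglongrightarrow> Ps t i j + \<beta> * (0 - 0)"
      using that by (intro tendsto_intros Lam' R0 sub[OF b0]) auto
    then show ?thesis by (simp add: R_def resid_def algebra_simps)
  qed
  have grad_u: "(\<lambda>n. lam (\<sigma> n) i + \<beta> * ((\<Sum>t<N. y (\<sigma> n) t i) - u (Suc (\<sigma> n)) i)) \<longlonglongrightarrow> ws i"
    if "i < m" for i
  proof -
    have "(\<lambda>n. lam (\<sigma> n) i + \<beta> * (q (Suc (\<sigma> n)) i
        - (Yv (y (Suc (\<sigma> n))) (z (Suc (\<sigma> n))) (Inl i) - Yv (y (\<sigma> n)) (z (\<sigma> n)) (Inl i))))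
        \<longlonglongrightarrow> ws i + \<beta> * (0 - 0)"
      using that by (intro tendsto_intros lam' q0 sub[OF b0]) auto
    then show ?thesis by (simp add: q_def algebra_simps)
  qed
  have comp: "0 \<le> Vs t i j \<and> 0 \<le> Ps t i j \<and> Vs t i j * Ps t i j = 0"
    if "t < N" "i < m" "j < mt t" for t i j
  proof (intro conjI)
    show "0 \<le> Vs t i j"
      by (rule LIMSEQ_le_const[OF V]) (use V_nonneg that in blast)
    show "0 \<le> Ps t i j"
      \<comment> \<open>The sign is known for the gradient in the \<open>V\<close>-step, which
        shares its limit with \<open>Lam\<close>.\<close>
      by (rule LIMSEQ_le_const[OF grad_V[OF that]])
        (use arg_min_V_complementarity(1)[OF step1 that] in blast)
    have "(\<lambda>n. (Lam (\<sigma> n) t i j + \<beta> * resid D (V (Suc (\<sigma> n))) (y (\<sigma> n)) (z (\<sigma> n)) t i j)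
        * V (Suc (\<sigma> n)) t i j) \<longlonglongrightarrow> Ps t i j * Vs t i j"
      by (intro tendsto_mult grad_V V that)
    then have "Ps t i j * Vs t i j = 0"
      unfolding arg_min_V_complementarity(2)[OF step1 that] by (simp add: LIMSEQ_const_iff)
    then show "Vs t i j * Ps t i j = 0" by (simp add: mult.commute)
  qed
  have sub_u: "us i \<le> (\<Sum>i<m. ws i * us i)" if "i < m" for i
  proof (rule LIMSEQ_le[OF u])
    show "(\<lambda>n. \<Sum>i<m. (lam (\<sigma> n) i + \<beta> * ((\<Sum>t<N. y (\<sigma> n) t i) - u (Suc (\<sigma> n)) i)) * u (Suc (\<sigma> n)) i)
        \<longlonglongrightarrow> (\<Sum>i<m. ws i * us i)"
      by (intro tendsto_sum tendsto_mult grad_u u) auto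
    \<comment> \<open>The subgradient inequality tested at 0 bounds the maximum by the pairing.
      Bounding each coordinate separately lets the limit be taken without continuity of the
      maximum.\<close>
    have "u (Suc k) i \<le> (\<Sum>i<m. (lam k i + \<beta> * ((\<Sum>t<N. y k t i) - u (Suc k) i)) * u (Suc k) i)" for k
    proof -
      have "(\<lambda>_::nat. 0::real) ` {..<m} = {0}" using m by (auto simp: image_constant_conv lessThan_empty_iff)
      then have "Max (u (Suc k) ` {..<m})
          \<le> (\<Sum>i<m. (lam k i + \<beta> * ((\<Sum>t<N. y k t i) - u (Suc k) i)) * u (Suc k) i)"
        using arg_min_u_subgradient[OF step1, of "\<lambda>_. 0" k] by (simp add: vecs_def sum_negf)
      with le_Max[OF that] show ?thesis by (rule order_trans)
    qed
    then show "\<exists>K. \<forall>n\<ge>K. u (Suc (\<sigma> n)) i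
        \<le> (\<Sum>i<m. (lam (\<sigma> n) i + \<beta> * ((\<Sum>t<N. y (\<sigma> n) t i) - u (Suc (\<sigma> n)) i)) * u (Suc (\<sigma> n)) i)"
      by blast
  qed
  have "KKT us Vs ys zs ws Ps"
    unfolding KKT_def using D P comp sub_u by blast
  then show thesis by (rule that) (fact u V y z lam Lam M Y Ssum)+
qed

section \<open>From the energy decrease to convergence of all variables\<close>

theorem convergence:
  obtains us Vs ys zs ws Ps where "KKT us Vs ys zs ws Ps"
    "\<And>i. (\<lambda>n. u n i) \<longlonglongrightarrow> us i" "\<And>t i j. (\<lambda>n. V n t i j) \<longlonglongrightarrow> Vs t i j"
    "\<And>t i. (\<lambda>n. y n t i) \<longlonglongrightarrow> ys t i" "\<And>t j. (\<lambda>n. z n t j) \<longlonglongrightarrow> zs t j"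
    "\<And>i. (\<lambda>n. lam n i) \<longlonglongrightarrow> ws i" "\<And>t i j. (\<lambda>n. Lam n t i j) \<longlonglongrightarrow> Ps t i j"
proof -
  obtain \<kappa> \<epsilon> where w: "0 \<le> \<kappa>" "0 < \<epsilon>" "\<epsilon> \<le> 1" "\<kappa> + \<epsilon> \<le> 2 - \<tau>" "(1 - \<tau>)\<^sup>2 \<le> \<kappa> * (1 - \<epsilon>)"
    using golden_ratio_weights[OF tau] by blast
  \<comment> \<open>The coordinates of the energy: multipliers, image of \<open>(y, z)\<close> and
    entry sums; \<open>W\<close> holds their weights in \<open>descent\<close>. Targets are the KKT
    points in these coordinates.\<close>
  define G where "G = E <+> E <+> {..<N}"
  define W where "W = case_sum (\<lambda>e::nat + nat \<times> nat \<times> nat. 1 / (\<tau> * \<beta>)) (case_sum (\<lambda>e::nat + nat \<times> nat \<times> nat. \<beta>) \<omega>)"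
  define pt where "pt y' z' w P = case_sum (Mv w P) (case_sum (Yv y' z') (\<lambda>t. \<Sum>i<m. y' t i))" for y' z' w P
  define Z where "Z n = pt (y (Suc n)) (z (Suc n)) (lam (Suc n)) (Lam (Suc n))" for n
  define Tgt where "Tgt g \<longleftrightarrow> (\<exists>us Vs ys zs ws Ps. KKT us Vs ys zs ws Ps \<and> g = pt ys zs ws Ps)" for g
  define H where "H n = (\<Sum>e\<in>E. \<kappa> * \<beta> * (r (Suc n) e)\<^sup>2) + (\<Sum>t<N. \<omega> t * (S (Suc n) t - S n t)\<^sup>2)" for n
  define dis where "dis n = (\<Sum>e\<in>E. \<epsilon> * \<beta> * ((r (Suc (Suc n)) e)\<^sup>2
            + (Yv (y (Suc (Suc n))) (z (Suc (Suc n))) e - Yv (y (Suc n)) (z (Suc n)) e)\<^sup>2))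
        + (\<Sum>t<N. \<omega> t * (S (Suc (Suc n)) t - S (Suc n) t)\<^sup>2)" for n
  have finG: "finite G" by (simp add: G_def)
  have W: "0 < W g" if "g \<in> G" for g
    using that beta tau(1) \<omega>_pos by (auto simp: G_def W_def)
  have \<omega>0: "0 \<le> \<omega> t" if "t < N" for t using \<omega>_pos[OF that] by simp
  have H0: "0 \<le> H n" for n
    unfolding H_def using w beta \<omega>0 by (intro add_nonneg_nonneg sum_nonneg) auto
  have dis0: "0 \<le> dis n" for n
    unfolding dis_def using w beta \<omega>0 by (intro add_nonneg_nonneg sum_nonneg) auto
  have dist: "(\<Sum>g\<in>G. W g * (Z n g - pt ys zs ws Ps g)\<^sup>2)
      = (\<Sum>e\<in>E. (Mv (lam (Suc n)) (Lam (Suc n)) e - Mv ws Ps e)\<^sup>2 / (\<tau> * \<beta>)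
          + \<beta> * (Yv (y (Suc n)) (z (Suc n)) e - Yv ys zs e)\<^sup>2)
        + (\<Sum>t<N. \<omega> t * (S (Suc n) t - (\<Sum>i<m. ys t i))\<^sup>2)" for n ys zs ws Ps
    by (simp add: G_def W_def Z_def pt_def S_def sum.Plus sum.distrib)
  have step: "(\<Sum>g\<in>G. W g * (Z (Suc n) g - x g)\<^sup>2) + H (Suc n) + dis n
      \<le> (\<Sum>g\<in>G. W g * (Z n g - x g)\<^sup>2) + H n" if x: "Tgt x" for x n
  proof -
    obtain us Vs ys zs ws Ps where K: "KKT us Vs ys zs ws Ps" and x: "x = pt ys zs ws Ps"
      using x unfolding Tgt_def by blast
    from descent[OF K w(1,3-5), of n] show ?thesis
      unfolding x dist H_def dis_def .
  qed
  obtain x0 where x0: "Tgt x0" using KKT_exists unfolding Tgt_def by blast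
  have "dis \<longlonglongrightarrow> 0"
  proof (rule nonneg_descent_tendsto_0)
    show "0 \<le> (\<Sum>g\<in>G. W g * (Z n g - x0 g)\<^sup>2) + H n" for n
      using W H0 by (intro add_nonneg_nonneg sum_nonneg) (auto simp: less_imp_le)
  qed (use dis0 step[OF x0] in auto)
  have le_dis: "\<epsilon> * \<beta> * ((r (Suc (Suc n)) e)\<^sup>2
        + (Yv (y (Suc (Suc n))) (z (Suc (Suc n))) e - Yv (y (Suc n)) (z (Suc n)) e)\<^sup>2) \<le> dis n"
    if "e \<in> E" for e n
  proof -
    have "\<epsilon> * \<beta> * ((r (Suc (Suc n)) e)\<^sup>2
        + (Yv (y (Suc (Suc n))) (z (Suc (Suc n))) e - Yv (y (Suc n)) (z (Suc n)) e)\<^sup>2)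
      \<le> (\<Sum>e\<in>E. \<epsilon> * \<beta> * ((r (Suc (Suc n)) e)\<^sup>2
            + (Yv (y (Suc (Suc n))) (z (Suc (Suc n))) e - Yv (y (Suc n)) (z (Suc n)) e)\<^sup>2))"
      using that w beta by (intro member_le_sum) auto
    moreover have "0 \<le> (\<Sum>t<N. \<omega> t * (S (Suc (Suc n)) t - S (Suc n) t)\<^sup>2)"
      using \<omega>0 by (intro sum_nonneg) auto
    ultimately show ?thesis unfolding dis_def by linarith
  qed
  have le_dis': "\<omega> t * (S (Suc (Suc n)) t - S (Suc n) t)\<^sup>2 \<le> dis n" if "t < N" for t n
  proof -
    have "\<omega> t * (S (Suc (Suc n)) t - S (Suc n) t)\<^sup>2 \<le> (\<Sum>t<N. \<omega> t * (S (Suc (Suc n)) t - S (Suc n) t)\<^sup>2)"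
      using that \<omega>0 by (intro member_le_sum) auto
    moreover have "0 \<le> (\<Sum>e\<in>E. \<epsilon> * \<beta> * ((r (Suc (Suc n)) e)\<^sup>2
            + (Yv (y (Suc (Suc n))) (z (Suc (Suc n))) e - Yv (y (Suc n)) (z (Suc n)) e)\<^sup>2))"
      using w beta by (intro sum_nonneg) auto
    ultimately show ?thesis unfolding dis_def by linarith
  qed
  \<comment> \<open>The discrepancy \<open>dis n\<close> involves the second step onwards, hence the
    shift in \<open>f\<close>.\<close>
  have null: "f \<longlonglongrightarrow> 0" if "0 < c" "\<And>n. c * (f (Suc n))\<^sup>2 \<le> dis n" for c and f :: "nat \<Rightarrow> real"
  proof -
    have "(\<lambda>n. c * (f (Suc n))\<^sup>2) \<longlonglongrightarrow> 0"
      by (rule tendsto_sandwich[OF _ _ tendsto_const \<open>dis \<longlonglongrightarrow> 0\<close>]) (use that in auto)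
    from tendsto_mult_left[OF this, of "1 / c"] have "(\<lambda>n. (f (Suc n))\<^sup>2) \<longlonglongrightarrow> 0"
      using that by simp
    then show ?thesis by (simp add: power_tendsto_0_iff filterlim_sequentially_Suc)
  qed
  have \<epsilon>\<beta>: "0 < \<epsilon> * \<beta>" using w beta by simp
  have r0: "(\<lambda>n. r (Suc n) e) \<longlonglongrightarrow> 0" if "e \<in> E" for e
    by (rule null[OF \<epsilon>\<beta>], rule order_trans[OF _ le_dis[OF that]]) (use \<epsilon>\<beta> in \<open>simp add: mult_le_cancel_left_pos\<close>)
  have b0: "(\<lambda>n. Yv (y (Suc n)) (z (Suc n)) e - Yv (y n) (z n) e) \<longlonglongrightarrow> 0" if "e \<in> E" for e
    by (rule null[OF \<epsilon>\<beta>], rule order_trans[OF _ le_dis[OF that]]) (use \<epsilon>\<beta> in \<open>simp add: mult_le_cancel_left_pos\<close>)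
  have d0: "(\<lambda>n. S (Suc n) t - S n t) \<longlonglongrightarrow> 0" if "t < N" for t
    by (rule null[OF \<omega>_pos[OF that] le_dis'[OF that]])
  have "H \<longlonglongrightarrow> (\<Sum>e\<in>E. \<kappa> * \<beta> * 0\<^sup>2) + (\<Sum>t<N. \<omega> t * 0\<^sup>2)"
    unfolding H_def by (intro tendsto_intros r0 d0) auto
  then have "H \<longlonglongrightarrow> 0" by simp
  obtain x where lim: "\<And>g. g \<in> G \<Longrightarrow> (\<lambda>n. Z n g) \<longlonglongrightarrow> x g"
  proof (rule fejer_convergence[where P = Tgt and Z = Z, OF finG W H0 \<open>H \<longlonglongrightarrow> 0\<close> x0])
    show "(\<Sum>g\<in>G. W g * (Z (Suc n) g - x g)\<^sup>2) + H (Suc n) \<le> (\<Sum>g\<in>G. W g * (Z n g - x g)\<^sup>2) + H n"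
      if "Tgt x" for x n
      using step[OF that, of n] dis0[of n] by linarith
  next
    fix \<sigma> :: "nat \<Rightarrow> nat" and x
    assume \<sigma>: "strict_mono \<sigma>" and lim: "\<And>g. g \<in> G \<Longrightarrow> (\<lambda>k. Z (\<sigma> k) g) \<longlonglongrightarrow> x g"
    obtain us Vs ys zs ws Ps where K: "KKT us Vs ys zs ws Ps"
      and eq: "\<And>e. e \<in> E \<Longrightarrow> Mv ws Ps e = x (Inl e)" "\<And>e. e \<in> E \<Longrightarrow> Yv ys zs e = x (Inr (Inl e))"
        "\<And>t. t < N \<Longrightarrow> (\<Sum>i<m. ys t i) = x (Inr (Inr t))"
    proof (rule KKT_limit[OF \<sigma> r0 b0 d0])
      show "(\<lambda>n. Mv (lam (Suc (\<sigma> n))) (Lam (Suc (\<sigma> n))) e) \<longlonglongrightarrow> x (Inl e)" if "e \<in> E" for e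
        using lim[of "Inl e"] that by (simp add: Z_def pt_def G_def InlI)
      show "(\<lambda>n. Yv (y (Suc (\<sigma> n))) (z (Suc (\<sigma> n))) e) \<longlonglongrightarrow> x (Inr (Inl e))" if "e \<in> E" for e
        using lim[of "Inr (Inl e)"] that by (simp add: Z_def pt_def G_def InlI InrI)
      show "(\<lambda>n. S (Suc (\<sigma> n)) t) \<longlonglongrightarrow> x (Inr (Inr t))" if "t < N" for t
        using lim[of "Inr (Inr t)"] that by (simp add: Z_def pt_def G_def InrI S_def)
    qed blast+
    have "pt ys zs ws Ps g = x g" if "g \<in> G" for g
      using that eq by (auto simp: G_def pt_def)
    then show "\<exists>z'. Tgt z' \<and> (\<forall>g\<in>G. z' g = x g)"
      using K unfolding Tgt_def by blast
  next
    fix x assume "\<And>g. g \<in> G \<Longrightarrow> (\<lambda>n. Z n g) \<longlonglongrightarrow> x g"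
    then show thesis by (rule that)
  qed
  \<comment> \<open>Now all of \<open>Z\<close> converges, so \<open>KKT_limit\<close> with the
    identity as subsequence delivers the original variables together with a KKT limit.\<close>
  have id: "strict_mono (\<lambda>n::nat. n)" by (simp add: strict_mono_def)
  show thesis
  proof (rule KKT_limit[OF id r0 b0 d0])
    show "(\<lambda>n. Mv (lam (Suc n)) (Lam (Suc n)) e) \<longlonglongrightarrow> x (Inl e)" if "e \<in> E" for e
      using lim[of "Inl e"] that by (simp add: Z_def pt_def G_def InlI)
    show "(\<lambda>n. Yv (y (Suc n)) (z (Suc n)) e) \<longlonglongrightarrow> x (Inr (Inl e))" if "e \<in> E" for e
      using lim[of "Inr (Inl e)"] that by (simp add: Z_def pt_def G_def InlI InrI)
    show "(\<lambda>n. S (Suc n) t) \<longlonglongrightarrow> x (Inr (Inr t))" if "t < N" for t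
      using lim[of "Inr (Inr t)"] that by (simp add: Z_def pt_def G_def InrI S_def)
  next
    fix us Vs ys zs ws Ps
    assume K: "KKT us Vs ys zs ws Ps"
      and l: "\<And>i. (\<lambda>n. u (Suc n) i) \<longlonglongrightarrow> us i" "\<And>t i j. (\<lambda>n. V (Suc n) t i j) \<longlonglongrightarrow> Vs t i j"
        "\<And>t i. (\<lambda>n. y (Suc n) t i) \<longlonglongrightarrow> ys t i" "\<And>t j. (\<lambda>n. z (Suc n) t j) \<longlonglongrightarrow> zs t j"
        "\<And>i. (\<lambda>n. lam (Suc n) i) \<longlonglongrightarrow> ws i" "\<And>t i j. (\<lambda>n. Lam (Suc n) t i j) \<longlonglongrightarrow> Ps t i j"
    show thesis
      by (rule that[OF K]; rule LIMSEQ_imp_Suc; fact l)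
  qed
qed

end

theorem theorem7:
  fixes N m :: nat and mt :: "nat \<Rightarrow> nat"
    and D :: "nat \<Rightarrow> nat \<Rightarrow> nat \<Rightarrow> real" and a :: "nat \<Rightarrow> nat \<Rightarrow> real"
    and \<beta> \<tau> :: real
    and u lam :: "nat \<Rightarrow> nat \<Rightarrow> real"
    and y z zt :: "nat \<Rightarrow> nat \<Rightarrow> nat \<Rightarrow> real"
    and V Lam :: "nat \<Rightarrow> nat \<Rightarrow> nat \<Rightarrow> nat \<Rightarrow> real"
  assumes N: "1 \<le> N" and m: "1 \<le> m" and mt: "\<forall>t<N. 1 \<le> mt t"
    and a_dom: "a \<in> famVecT N mt"
    and a_nonneg: "\<forall>t<N. \<forall>j<mt t. 0 \<le> a t j"
    and a_sum: "\<forall>t<N. (\<Sum>j<mt t. a t j) = 1"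
    and beta: "0 < \<beta>"
    and tau: "0 < \<tau>" "\<tau> < (1 + sqrt 5) / 2"
    and init: "u 0 \<in> vecs m" "lam 0 \<in> vecs m" "y 0 \<in> famVec N m" "z 0 \<in> famVecT N mt"
      "V 0 \<in> famMat N m mt" "\<forall>t<N. \<forall>i<m. \<forall>j<mt t. 0 \<le> V 0 t i j"
      "Lam 0 \<in> famMat N m mt"
    and step1: "\<forall>k. is_arg_min (\<lambda>(u', V'). AL N m mt a D \<beta> u' V' (y k) (z k) (lam k) (Lam k))
                   (\<lambda>p. p \<in> vecs m \<times> famMat N m mt) (u (Suc k), V (Suc k))"
    and step2a: "\<forall>k. is_arg_min (\<lambda>z'. AL N m mt a D \<beta> (u (Suc k)) (V (Suc k)) (y k) z' (lam k) (Lam k))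
                   (\<lambda>z'. z' \<in> famVecT N mt) (zt (Suc k))"
    and step2b: "\<forall>k. is_arg_min (\<lambda>y'. AL N m mt a D \<beta> (u (Suc k)) (V (Suc k)) y' (zt (Suc k)) (lam k) (Lam k))
                   (\<lambda>y'. y' \<in> famVec N m) (y (Suc k))"
    and step2c: "\<forall>k. is_arg_min (\<lambda>z'. AL N m mt a D \<beta> (u (Suc k)) (V (Suc k)) (y (Suc k)) z' (lam k) (Lam k))
                   (\<lambda>z'. z' \<in> famVecT N mt) (z (Suc k))"
    and step3a: "\<forall>k. lam (Suc k) =
                   (\<lambda>i. lam k i + \<tau> * \<beta> * ((\<Sum>t<N. y (Suc k) t i) - u (Suc k) i))"
    and step3b: "\<forall>k. Lam (Suc k) = (\<lambda>t i j. if t < N \<and> i < m \<and> j < mt t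
                   then Lam k t i j + \<tau> * \<beta> * resid D (V (Suc k)) (y (Suc k)) (z (Suc k)) t i j
                   else 0)"
  shows "(\<exists>us Vs ys zs. D_optimal N m mt a D us Vs ys zs \<and>
            (\<forall>i. (\<lambda>k. u k i) \<longlonglongrightarrow> us i) \<and>
            (\<forall>t i j. (\<lambda>k. V k t i j) \<longlonglongrightarrow> Vs t i j) \<and>
            (\<forall>t i. (\<lambda>k. y k t i) \<longlonglongrightarrow> ys t i) \<and>
            (\<forall>t j. (\<lambda>k. z k t j) \<longlonglongrightarrow> zs t j)) \<and>
         (\<exists>ws Pis. P_optimal N m mt a D ws Pis \<and>
            (\<forall>i. (\<lambda>k. lam k i) \<longlonglongrightarrow> ws i) \<and>
            (\<forall>t i j. (\<lambda>k. Lam k t i j) \<longlonglongrightarrow> Pis t i j))"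
proof -
  interpret barycenter_admm N m mt D a \<beta> \<tau> u lam y z zt V Lam
    by unfold_locales (use assms in blast)+
  show ?thesis
  proof (rule convergence)
    fix us Vs ys zs ws Ps
    assume "KKT us Vs ys zs ws Ps"
      and lim: "\<And>i. (\<lambda>n. u n i) \<longlonglongrightarrow> us i" "\<And>t i j. (\<lambda>n. V n t i j) \<longlonglongrightarrow> Vs t i j"
        "\<And>t i. (\<lambda>n. y n t i) \<longlonglongrightarrow> ys t i" "\<And>t j. (\<lambda>n. z n t j) \<longlonglongrightarrow> zs t j"
        "\<And>i. (\<lambda>n. lam n i) \<longlonglongrightarrow> ws i" "\<And>t i j. (\<lambda>n. Lam n t i j) \<longlonglongrightarrow> Ps t i j"
    then show ?thesis
      by (intro conjI exI[of _ us] exI[of _ Vs] exI[of _ ys] exI[of _ zs] exI[of _ ws] exI[of _ Ps] allI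
          KKT_optimal lim)
  qed
qed

end
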